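(* Let $a,b$ be integers with $2\le a\le b-2$, let $\rho$ be a root of the polynomial $x^3-(a+b)x^2+abx-1$, and write $b-a=2L+l_0$ with $L\in\mathbb Z$ and $l_0\in\{0,1\}$. For integers $v,W$ put $\alpha(v,W)=-v+(b(av+W)+1)\rho-(av+W)\rho^2$. If $\alpha$ is indecomposable in $\mathbb Z[\rho]$, then \[ N(\alpha)\le \begin{cases} 16 & \text{if } a=2 \text{ and } b=4,\\ \max\{N(\alpha(v,a-1)) : v\in\mathbb Z,\ L-1\le v\le 2L-1\} & \text{if } (a,b)\ne(2,4) \text{ and } l_0=0,\\ \max\{N(\alpha(v,a-1)) : v\in\mathbb Z,\ L\le v\le 2L\} & \text{if } l_0=1. \end{cases} \]
   Context: The field $K=\mathbb Q(\rho)$ is a totally real cubic field and $\mathbb Z[\rho]$ is an order in it. An element of $K$ is totally positive if all its images under the embeddings $K\to\mathbb R$ are positive. A totally positive $\alpha\in\mathbb Z[\rho]$ is indecomposable in $\mathbb Z[\rho]$ if it cannot be written as $\alpha=\beta+\gamma$ with $\beta,\gamma\in\mathbb Z[\rho]$ totally positive. $N$ denotes the norm from $K$ to $\mathbb Q$. *)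

theory Defs
  imports Complex_Main "HOL-Library.FuncSet" "HOL-Computational_Algebra.Polynomial"
begin

definition order_adjoin :: "'a::field_char_0 \<Rightarrow> 'a set" where
  "order_adjoin \<rho> = {poly (map_poly of_int p) \<rho> | p :: int poly. True}"

definition field_adjoin :: "'a::field_char_0 \<Rightarrow> 'a set" where
  "field_adjoin \<rho> =
     {poly (map_poly of_rat p) \<rho> / poly (map_poly of_rat q) \<rho> | p q :: rat poly.
        poly (map_poly of_rat q) \<rho> \<noteq> 0}"

(* Embeddings are taken to be extensional (undefined outside K), so that an embedding is
   determined by its values on K and a product over all embeddings has one factor for each. *)
definition field_embeddings :: "'a::field_char_0 set \<Rightarrow> ('a \<Rightarrow> 'b::field_char_0) set" where
  "field_embeddings K =
     {\<sigma> \<in> extensional K. \<sigma> 1 = 1 \<and>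
        (\<forall>x\<in>K. \<forall>y\<in>K. \<sigma> (x + y) = \<sigma> x + \<sigma> y \<and> \<sigma> (x * y) = \<sigma> x * \<sigma> y)}"

definition totally_positive :: "'a::field_char_0 set \<Rightarrow> 'a \<Rightarrow> bool" where
  "totally_positive K \<alpha> \<longleftrightarrow>
     \<alpha> \<in> K \<and> (\<forall>\<sigma> \<in> (field_embeddings K :: ('a \<Rightarrow> real) set). \<sigma> \<alpha> > 0)"

(* The norm from a number field K to the rationals, as the product of the images under all
   complex embeddings of K; this product is a rational number. *)
definition field_norm :: "'a::field_char_0 set \<Rightarrow> 'a \<Rightarrow> rat" where
  "field_norm K \<alpha> =
     (THE q. of_rat q = (\<Prod>\<sigma> \<in> (field_embeddings K :: ('a \<Rightarrow> complex) set). \<sigma> \<alpha>))"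

definition indecomposable_in :: "'a::field_char_0 set \<Rightarrow> 'a set \<Rightarrow> 'a \<Rightarrow> bool" where
  "indecomposable_in K R \<alpha> \<longleftrightarrow>
     \<alpha> \<in> R \<and> totally_positive K \<alpha> \<and>
     \<not> (\<exists>\<beta>\<in>R. \<exists>\<gamma>\<in>R. totally_positive K \<beta> \<and> totally_positive K \<gamma> \<and> \<alpha> = \<beta> + \<gamma>)"

definition alpha :: "int \<Rightarrow> int \<Rightarrow> 'a::field_char_0 \<Rightarrow> int \<Rightarrow> int \<Rightarrow> 'a" where
  "alpha a b \<rho> v W =
     - of_int v + of_int (b * (a * v + W) + 1) * \<rho> - of_int (a * v + W) * \<rho> ^ 2"

end

theory Submission
  imports Defs "HOL-Computational_Algebra.Polynomial_Factorial"
    "HOL-Computational_Algebra.Field_as_Ring" "HOL-Library.Product_Plus"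
begin

text \<open>
  The polynomial is \<open>x (x - a) (x - b) - 1\<close>, so \<open>\<rho>\<close>, \<open>\<rho> - a\<close> and \<open>\<rho> - b\<close> are units, and
  multiplication by \<open>\<rho> - b\<close> turns totally positive elements into elements of signature
  \<open>(-, -, +)\<close> at the three roots in increasing order. On this signature the totally positive
  units \<open>\<rho>\<close> and \<open>(\<rho> - a) / (\<rho> - b)\<close> act, and the translates of the quadrilateral with vertices
  \<open>\<rho> - a\<close>, \<open>\<rho> - b\<close>, \<open>\<rho> (\<rho> - b)\<close>, \<open>\<rho> (\<rho> - a)\<close>, cut along the diagonal from \<open>\<rho> - a\<close>
  to \<open>\<rho> (\<rho> - b)\<close>, form a locally convex polyhedral surface. Among all associates of an
  indecomposable element choose one on which one of the two face functionals is minimal. Local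
  convexity across the three edges of that face puts it into the cone over the face, and there the
  only indecomposable elements are \<open>\<rho> - c\<close> and \<open>\<rho> (\<rho> - c)\<close> for \<open>a \<le> c \<le> b\<close>, and
  \<open>\<rho>\<^sup>2 - (v + a) \<rho> - W\<close> for \<open>0 \<le> v < b - a\<close> and \<open>1 \<le> W < a\<close>. The latter is the unit multiple
  \<open>\<alpha>(v, W) / (\<rho> (\<rho> - b))\<close> of \<open>\<alpha>(v, W)\<close>, and the norms compare by elementary inequalities.
\<close>

section \<open>Embeddings of simple extensions\<close>

abbreviation rpoly :: "rat poly \<Rightarrow> 'a::field_char_0 \<Rightarrow> 'a" where
  "rpoly p x \<equiv> poly (map_poly of_rat p) x"

lemma rpoly_pCons [simp]: "rpoly (pCons c p) x = of_rat c + x * rpoly p x"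
  by (simp add: map_poly_pCons)

lemma rpoly_add [simp]: "rpoly (p + q) x = rpoly p x + rpoly q x"
proof (induction p arbitrary: q)
  case (pCons c p)
  obtain d q' where "q = pCons d q'" by (cases q)
  with pCons.IH[of q'] show ?case by (simp add: of_rat_add algebra_simps)
qed simp

lemma rpoly_smult [simp]: "rpoly (smult c p) x = of_rat c * rpoly p x"
  by (induction p) (simp_all add: of_rat_mult algebra_simps)

lemma rpoly_minus [simp]: "rpoly (- p) x = - rpoly p x"
  using rpoly_smult[of "-1" p x] by simp

lemma rpoly_diff [simp]: "rpoly (p - q) x = rpoly p x - rpoly q x"
  using rpoly_add[of p "- q" x] by simp

lemma rpoly_mult [simp]: "rpoly (p * q) x = rpoly p x * rpoly q x"
  by (induction p) (simp_all add: algebra_simps)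

text \<open>If \<open>F\<close> did not divide \<open>p\<close>, the two would be coprime, and a
  Bezout identity evaluated at \<open>x\<close> would read 0 = 1. Hence all roots of
  \<open>F\<close>, in whatever field, annihilate the same rational polynomials.\<close>

lemma rpoly_eq_0_iff_dvd:
  fixes x :: "'a::field_char_0"
  assumes F: "irreducible F" "rpoly F x = 0"
  shows "rpoly p x = 0 \<longleftrightarrow> F dvd p"
proof
  assume p: "rpoly p x = 0"
  show "F dvd p"
  proof (rule ccontr)
    assume "\<not> F dvd p"
    then have "coprime F p"
      using F(1) field_poly_irreducible_imp_prime prime_elem_imp_coprime by blast
    then obtain u v where "u * F + v * p = 1"
      by (metis bezout_coefficients_fst_snd coprime_iff_gcd_eq_1)
    then have "rpoly (u * F + v * p) x = 1"
      by simp
    then show False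
      using F(2) p by (simp only: rpoly_add rpoly_mult) simp
  qed
next
  assume "F dvd p"
  then show "rpoly p x = 0"
    using F(2) by (auto elim!: dvdE)
qed

text \<open>A proper factorisation of a cubic contains a linear factor, and a linear factor has a
  root.\<close>

lemma irreducible_cubic:
  fixes F :: "'a::field poly"
  assumes deg: "degree F = 3" and no_root: "\<And>x. poly F x \<noteq> 0"
  shows "irreducible F"
proof -
  have no_linear: "degree p \<noteq> 1" if "p dvd F" for p
  proof
    assume "degree p = 1"
    then obtain c d where p: "p = [:c, d:]" "d \<noteq> 0"
      by (cases p; cases "tl (coeffs p)") (auto elim!: degree_eq_zeroE split: if_splits)
    then have "poly p (- c / d) = 0"
      by simp
    with \<open>p dvd F\<close> have "poly F (- c / d) = 0"
      by (auto elim!: dvdE)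
    with no_root show False by blast
  qed
  show ?thesis
  proof (rule irreducibleI)
    show "F \<noteq> 0" using deg by auto
    show "\<not> F dvd 1" using deg by (auto simp: is_unit_poly_iff)
    fix p q assume pq: "F = p * q"
    then have nz: "p \<noteq> 0" "q \<noteq> 0" using \<open>F \<noteq> 0\<close> by auto
    have "degree p + degree q = 3"
      using deg nz by (simp add: pq degree_mult_eq)
    moreover have "degree p \<noteq> 1" "degree q \<noteq> 1"
      using no_linear pq by auto
    ultimately have "degree p = 0 \<or> degree q = 0"
      by linarith
    then show "p dvd 1 \<or> q dvd 1"
      using nz by (auto simp: is_unit_iff_degree)
  qed
qed

lemma field_adjoinI: "rpoly q x \<noteq> 0 \<Longrightarrow> rpoly p x / rpoly q x \<in> field_adjoin x"
  unfolding field_adjoin_def by blast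

lemma rpoly_in_field_adjoin: "rpoly p x \<in> field_adjoin x"
  using field_adjoinI[of 1 x p] by simp

lemma field_adjoinE:
  assumes "y \<in> field_adjoin x"
  obtains p q where "rpoly q x \<noteq> 0" "y = rpoly p x / rpoly q x"
  using assms unfolding field_adjoin_def by blast

lemma of_rat_in_field_adjoin: "of_rat c \<in> field_adjoin x"
  using rpoly_in_field_adjoin[of "[:c:]" x] by simp

lemma self_in_field_adjoin: "x \<in> field_adjoin x"
  using rpoly_in_field_adjoin[of "[:0, 1:]" x] by simp

lemma field_adjoin_mult:
  assumes "y \<in> field_adjoin x" "z \<in> field_adjoin x"
  shows "y * z \<in> field_adjoin x"
proof -
  obtain p q where pq: "rpoly q x \<noteq> 0" "y = rpoly p x / rpoly q x"
    using assms(1) by (rule field_adjoinE)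
  obtain p' q' where pq': "rpoly q' x \<noteq> 0" "z = rpoly p' x / rpoly q' x"
    using assms(2) by (rule field_adjoinE)
  have "y * z = rpoly (p * p') x / rpoly (q * q') x"
    unfolding pq(2) pq'(2) using pq(1) pq'(1) by (simp add: field_simps)
  then show ?thesis
    using field_adjoinI[of "q * q'" x] pq(1) pq'(1) by (metis mult_eq_0_iff rpoly_mult)
qed

text \<open>Substitution of \<open>r\<close> for \<open>x\<close> in fractions of polynomials. A
  description is used because an element has many such fractions; the restriction makes the map
  extensional, as \<open>field_embeddings\<close> demands.\<close>

definition adjoin_embedding ::
    "'a::field_char_0 \<Rightarrow> 'b::field_char_0 \<Rightarrow> 'a \<Rightarrow> 'b" where
  "adjoin_embedding x r = (\<lambda>y\<in>field_adjoin x.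
     THE z. \<exists>p q. rpoly q x \<noteq> 0 \<and> y = rpoly p x / rpoly q x \<and> z = rpoly p r / rpoly q r)"

text \<open>Cross-multiplying two fractions for the same element gives a polynomial vanishing at
  \<open>x\<close>, hence also at \<open>r\<close>, so the value does not depend on the
  fraction.\<close>

lemma adjoin_embedding_div:
  fixes x :: "'a::field_char_0" and r :: "'b::field_char_0"
  assumes F: "irreducible F" "rpoly F x = 0" "rpoly F r = 0" and q: "rpoly q x \<noteq> 0"
  shows "adjoin_embedding x r (rpoly p x / rpoly q x) = rpoly p r / rpoly q r"
proof -
  have nz: "rpoly p r = 0 \<longleftrightarrow> rpoly p x = 0" for p
    using rpoly_eq_0_iff_dvd[OF F(1,2)] rpoly_eq_0_iff_dvd[OF F(1,3)] by simp
  have uniq: "rpoly p r / rpoly q r = rpoly p' r / rpoly q' r"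
    if "rpoly q' x \<noteq> 0" "rpoly p x / rpoly q x = rpoly p' x / rpoly q' x" for p' q'
  proof -
    have "rpoly (p * q' - p' * q) x = 0"
      using that q by (simp add: field_simps)
    then have "rpoly (p * q' - p' * q) r = 0"
      using nz by blast
    moreover have "rpoly q r \<noteq> 0" "rpoly q' r \<noteq> 0"
      using q that(1) nz by blast+
    ultimately show ?thesis
      by (simp add: field_simps)
  qed
  have "(THE z. \<exists>p' q'. rpoly q' x \<noteq> 0 \<and> rpoly p x / rpoly q x = rpoly p' x / rpoly q' x
      \<and> z = rpoly p' r / rpoly q' r) = rpoly p r / rpoly q r"
  proof (rule the_equality)
    show "\<exists>p' q'. rpoly q' x \<noteq> 0 \<and> rpoly p x / rpoly q x = rpoly p' x / rpoly q' x
      \<and> rpoly p r / rpoly q r = rpoly p' r / rpoly q' r"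
      using q by (intro exI conjI) (assumption | rule refl)+
  next
    fix z
    assume "\<exists>p' q'. rpoly q' x \<noteq> 0 \<and> rpoly p x / rpoly q x = rpoly p' x / rpoly q' x
      \<and> z = rpoly p' r / rpoly q' r"
    then show "z = rpoly p r / rpoly q r"
      by (elim exE conjE) (simp only: uniq)
  qed
  then show ?thesis
    using field_adjoinI[OF q] by (simp add: adjoin_embedding_def)
qed

lemma adjoin_embedding_rpoly:
  assumes "irreducible F" "rpoly F x = 0" "rpoly F r = 0"
  shows "adjoin_embedding x r (rpoly p x) = rpoly p r"
  using adjoin_embedding_div[OF assms, of 1 p] by simp

lemma adjoin_embedding_self:
  assumes "irreducible F" "rpoly F x = 0" "rpoly F r = 0"
  shows "adjoin_embedding x r x = r"
  using adjoin_embedding_rpoly[OF assms, of "[:0, 1:]"] by simp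

lemma adjoin_embedding_in_field_embeddings:
  fixes x :: "'a::field_char_0" and r :: "'b::field_char_0"
  assumes F: "irreducible F" "rpoly F x = 0" "rpoly F r = 0"
  shows "adjoin_embedding x r \<in> field_embeddings (field_adjoin x)"
proof -
  have nz: "rpoly p r = 0 \<longleftrightarrow> rpoly p x = 0" for p
    using rpoly_eq_0_iff_dvd[OF F(1,2)] rpoly_eq_0_iff_dvd[OF F(1,3)] by simp
  note emb = adjoin_embedding_div[OF F]
  have "adjoin_embedding x r (y + z) = adjoin_embedding x r y + adjoin_embedding x r z \<and>
        adjoin_embedding x r (y * z) = adjoin_embedding x r y * adjoin_embedding x r z"
    if yz: "y \<in> field_adjoin x" "z \<in> field_adjoin x" for y z
  proof -
    obtain p q where pq: "rpoly q x \<noteq> 0" "y = rpoly p x / rpoly q x"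
      using yz(1) by (rule field_adjoinE)
    obtain p' q' where pq': "rpoly q' x \<noteq> 0" "z = rpoly p' x / rpoly q' x"
      using yz(2) by (rule field_adjoinE)
    have nzr: "rpoly q r \<noteq> 0" "rpoly q' r \<noteq> 0"
      using pq(1) pq'(1) nz by blast+
    have nzx: "rpoly (q * q') x \<noteq> 0"
      using pq(1) pq'(1) by simp
    have "y + z = rpoly (p * q' + p' * q) x / rpoly (q * q') x"
         "y * z = rpoly (p * p') x / rpoly (q * q') x"
      unfolding pq(2) pq'(2) using pq(1) pq'(1) by (simp_all add: field_simps)
    then have "adjoin_embedding x r (y + z) = rpoly (p * q' + p' * q) r / rpoly (q * q') r"
         "adjoin_embedding x r (y * z) = rpoly (p * p') r / rpoly (q * q') r"
      using emb[OF nzx] by presburger+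
    then show ?thesis
      using nzr by (simp add: pq(2) pq'(2) emb[OF pq(1)] emb[OF pq'(1)] field_simps)
  qed
  moreover have "adjoin_embedding x r 1 = 1"
    using emb[of 1 1] by simp
  moreover have "adjoin_embedding x r \<in> extensional (field_adjoin x)"
    unfolding adjoin_embedding_def by simp
  ultimately show ?thesis
    unfolding field_embeddings_def by blast
qed

text \<open>The value at 1 and additivity fix the integers; multiplicativity then fixes their
  quotients.\<close>

lemma field_embedding_of_rat:
  fixes x :: "'a::field_char_0" and \<sigma> :: "'a \<Rightarrow> 'b::field_char_0"
  assumes \<sigma>: "\<sigma> \<in> field_embeddings (field_adjoin x)"
  shows "\<sigma> (of_rat c) = of_rat c"
proof -
  have one: "\<sigma> 1 = 1"
    and add: "\<sigma> (of_rat u + of_rat v) = \<sigma> (of_rat u) + \<sigma> (of_rat v)"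
    and mult: "\<sigma> (of_rat u * of_rat v) = \<sigma> (of_rat u) * \<sigma> (of_rat v)" for u v
    using \<sigma> of_rat_in_field_adjoin[of _ x] unfolding field_embeddings_def by blast+
  have zero: "\<sigma> 0 = 0"
    using add[of 0 0] by simp
  have nat: "\<sigma> (of_nat n) = of_nat n" for n
  proof (induction n)
    case (Suc n)
    then show ?case
      using add[of 1 "of_nat n"] one by simp
  qed (simp add: zero)
  have neg: "\<sigma> (- of_nat n) = - of_nat n" for n
    using add[of "of_nat n" "- of_nat n"] nat[of n] zero
    by (simp add: of_rat_minus eq_neg_iff_add_eq_0 add.commute)
  have int: "\<sigma> (of_int i) = of_int i" for i
    using nat neg by (cases i rule: int_cases2) (simp_all add: one)
  obtain m n where c: "c = of_int m / of_int n" "n \<noteq> 0"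
    by (metis quotient_of_div quotient_of_denom_pos less_numeral_extra(3) surj_pair)
  then have "\<sigma> (of_rat c * of_int n) = of_int m"
    using int[of m] by (simp add: of_rat_divide)
  then have "\<sigma> (of_rat c) * of_int n = of_int m"
    using mult[of c "of_int n"] int[of n] by simp
  then have "\<sigma> (of_rat c) = of_int m / of_int n"
    using c(2) by (simp add: eq_divide_eq)
  then show ?thesis
    by (simp add: c(1) of_rat_divide)
qed

lemma field_embedding_rpoly:
  fixes x :: "'a::field_char_0" and \<sigma> :: "'a \<Rightarrow> 'b::field_char_0"
  assumes \<sigma>: "\<sigma> \<in> field_embeddings (field_adjoin x)"
  shows "\<sigma> (rpoly p x) = rpoly p (\<sigma> x)"
proof -
  have add: "\<sigma> (u + v) = \<sigma> u + \<sigma> v" and mult: "\<sigma> (u * v) = \<sigma> u * \<sigma> v"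
    if "u \<in> field_adjoin x" "v \<in> field_adjoin x" for u v
    using \<sigma> that unfolding field_embeddings_def by blast+
  show ?thesis
  proof (induction p)
    case 0
    then show ?case using field_embedding_of_rat[OF \<sigma>, of 0] by simp
  next
    case (pCons c p)
    have "\<sigma> (of_rat c + x * rpoly p x) = \<sigma> (of_rat c) + \<sigma> x * \<sigma> (rpoly p x)"
      by (simp add: add mult of_rat_in_field_adjoin field_adjoin_mult self_in_field_adjoin
          rpoly_in_field_adjoin)
    then show ?case
      using pCons.IH field_embedding_of_rat[OF \<sigma>] by simp
  qed
qed

text \<open>An embedding commutes with rational polynomials, so it is pinned down by the image of
  \<open>x\<close>, which must be a root of \<open>F\<close>.\<close>

lemma field_embedding_eq_adjoin_embedding:
  fixes x :: "'a::field_char_0" and \<sigma> :: "'a \<Rightarrow> 'b::field_char_0"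
  assumes F: "irreducible F" "rpoly F x = 0" and \<sigma>: "\<sigma> \<in> field_embeddings (field_adjoin x)"
  shows "rpoly F (\<sigma> x) = 0" and "\<sigma> = adjoin_embedding x (\<sigma> x)"
proof -
  show root: "rpoly F (\<sigma> x) = 0"
    using field_embedding_rpoly[OF \<sigma>, of F] field_embedding_of_rat[OF \<sigma>, of 0] F(2) by simp
  have ext: "\<sigma> \<in> extensional (field_adjoin x)"
    using \<sigma> unfolding field_embeddings_def by blast
  show "\<sigma> = adjoin_embedding x (\<sigma> x)"
  proof (rule extensionalityI[OF ext])
    show "adjoin_embedding x (\<sigma> x) \<in> extensional (field_adjoin x)"
      unfolding adjoin_embedding_def by simp
    fix y assume y: "y \<in> field_adjoin x"
    then obtain p q where q: "rpoly q x \<noteq> 0" and ypq: "y = rpoly p x / rpoly q x"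
      by (rule field_adjoinE)
    have "\<sigma> (y * rpoly q x) = \<sigma> y * \<sigma> (rpoly q x)"
      using \<sigma> y rpoly_in_field_adjoin[of q x] unfolding field_embeddings_def by blast
    then have "rpoly p (\<sigma> x) = \<sigma> y * rpoly q (\<sigma> x)"
      using q by (simp add: ypq field_embedding_rpoly[OF \<sigma>])
    moreover have "rpoly q (\<sigma> x) \<noteq> 0"
      using q rpoly_eq_0_iff_dvd[OF F] rpoly_eq_0_iff_dvd[OF F(1) root] by simp
    ultimately show "\<sigma> y = adjoin_embedding x (\<sigma> x) y"
      unfolding ypq adjoin_embedding_div[OF F root q] by (simp add: eq_divide_eq)
  qed
qed

lemma field_embeddings_adjoin:
  fixes x :: "'a::field_char_0"
  assumes F: "irreducible F" "rpoly F x = 0"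
  shows "field_embeddings (field_adjoin x) =
    adjoin_embedding x ` {r :: 'b::field_char_0. rpoly F r = 0}"
proof (intro equalityI subsetI)
  fix \<sigma> :: "'a \<Rightarrow> 'b" assume "\<sigma> \<in> field_embeddings (field_adjoin x)"
  from field_embedding_eq_adjoin_embedding[OF F this]
  show "\<sigma> \<in> adjoin_embedding x ` {r. rpoly F r = 0}"
    by (intro image_eqI[of _ _ "\<sigma> x"]) simp_all
next
  fix \<sigma> :: "'a \<Rightarrow> 'b" assume "\<sigma> \<in> adjoin_embedding x ` {r. rpoly F r = 0}"
  then show "\<sigma> \<in> field_embeddings (field_adjoin x)"
    using adjoin_embedding_in_field_embeddings[OF F] by auto
qed

text \<open>Evaluation at \<open>x\<close> recovers \<open>r\<close>. This is what turns a product
  over embeddings into a product over roots.\<close>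

lemma inj_on_adjoin_embedding:
  fixes x :: "'a::field_char_0"
  assumes F: "irreducible F" "rpoly F x = 0"
  shows "inj_on (adjoin_embedding x) {r :: 'b::field_char_0. rpoly F r = 0}"
  by (rule inj_on_inverseI[of _ "\<lambda>\<sigma>. \<sigma> x"]) (simp add: adjoin_embedding_self[OF F])

section \<open>Coordinates with respect to the powers of a root\<close>

text \<open>Elements of the order are kept as integer triples, so that one triple can be evaluated
  at \<rho> and at each real conjugate.\<close>

definition ev :: "'a::comm_ring_1 \<Rightarrow> int \<times> int \<times> int \<Rightarrow> 'a" where
  "ev r = (\<lambda>(X, Y, Z). of_int X + of_int Y * r + of_int Z * r ^ 2)"

lemma ev_simp [simp]: "ev r (X, Y, Z) = of_int X + of_int Y * r + of_int Z * r ^ 2"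
  by (simp add: ev_def)

lemma ev_add: "ev r (s + t) = ev r s + ev r t"
  by (cases s; cases t) (simp add: algebra_simps)

text \<open>The product of \<open>ev\<close> over the three roots, expanded in their elementary
  symmetric functions \<open>a + b\<close>, \<open>a * b\<close> and 1.\<close>

definition cubic_norm :: "int \<Rightarrow> int \<Rightarrow> int \<times> int \<times> int \<Rightarrow> int" where
  "cubic_norm a b = (\<lambda>(X, Y, Z).
     X^3 + X^2 * Y * (a + b) + X^2 * Z * ((a + b)^2 - 2 * a * b) + X * Y^2 * (a * b)
     + X * Y * Z * ((a + b) * (a * b) - 3) + X * Z^2 * ((a * b)^2 - 2 * (a + b))
     + Y^3 + Y^2 * Z * (a + b) + Y * Z^2 * (a * b) + Z^3)"

definition mult_root :: "int \<Rightarrow> int \<Rightarrow> int \<times> int \<times> int \<Rightarrow> int \<times> int \<times> int" where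
  "mult_root a b = (\<lambda>(X, Y, Z). (Z, X - a * b * Z, Y + (a + b) * Z))"

text \<open>The inverse is integral because the constant term of the polynomial is -1:
  \<open>1 / r = r^2 - (a + b) * r + a * b\<close>.\<close>

definition div_root :: "int \<Rightarrow> int \<Rightarrow> int \<times> int \<times> int \<Rightarrow> int \<times> int \<times> int" where
  "div_root a b = (\<lambda>(X, Y, Z). (Y + a * b * X, Z - (a + b) * X, X))"

definition mult_shift :: "int \<Rightarrow> int \<Rightarrow> int \<Rightarrow> int \<times> int \<times> int \<Rightarrow> int \<times> int \<times> int" where
  "mult_shift a b c t = (case (mult_root a b t, t) of ((U, V, W), (X, Y, Z)) \<Rightarrow>
     (U - c * X, V - c * Y, W - c * Z))"

text \<open>Multiplication by \<open>(r - a) / (r - b) = 1 + (b - a) r (r - a)\<close>.\<close>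

definition mult_ratio :: "int \<Rightarrow> int \<Rightarrow> int \<times> int \<times> int \<Rightarrow> int \<times> int \<times> int" where
  "mult_ratio a b t = (case (mult_root a b (mult_shift a b a t), t) of ((U, V, W), (X, Y, Z)) \<Rightarrow>
     (X + (b - a) * U, Y + (b - a) * V, Z + (b - a) * W))"

lemma mult_div_root [simp]: "mult_root a b (div_root a b t) = t"
  by (cases t) (simp add: mult_root_def div_root_def)

lemma div_mult_root [simp]: "div_root a b (mult_root a b t) = t"
  by (cases t) (simp add: mult_root_def div_root_def)

lemma mult_root_add: "mult_root a b (s + t) = mult_root a b s + mult_root a b t"
  by (cases s; cases t) (simp add: mult_root_def algebra_simps)

lemma div_root_add: "div_root a b (s + t) = div_root a b s + div_root a b t"
  by (cases s; cases t) (simp add: div_root_def algebra_simps)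

lemma mult_shift_add: "mult_shift a b c (s + t) = mult_shift a b c s + mult_shift a b c t"
  by (cases s; cases t) (simp add: mult_shift_def mult_root_def algebra_simps)

lemma mult_ratio_add: "mult_ratio a b (s + t) = mult_ratio a b s + mult_ratio a b t"
  by (cases s; cases t) (simp add: mult_ratio_def mult_shift_def mult_root_def algebra_simps)

text \<open>Interchanging \<open>a\<close> and \<open>b\<close> keeps the polynomial and inverts the ratio.\<close>

lemma mult_ratio_inverse: "mult_ratio a b (mult_ratio b a t) = t"
proof (cases t)
  case (fields X Y Z)
  show ?thesis
    unfolding fields mult_ratio_def mult_shift_def mult_root_def prod.case prod.inject
    by (simp add: algebra_simps)
qed

context
  fixes r :: "'a::comm_ring_1" and a b :: int
  assumes root: "r * (r - of_int a) * (r - of_int b) = 1"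
begin

lemma root_cube: "r ^ 3 = of_int (a + b) * r ^ 2 - of_int (a * b) * r + 1"
  using root by (simp add: algebra_simps power2_eq_square power3_eq_cube)

lemma ev_mult_root: "ev r (mult_root a b t) = r * ev r t"
proof (cases t)
  case (fields X Y Z)
  have "r * (of_int X + of_int Y * r + of_int Z * r^2)
      = of_int X * r + of_int Y * r^2 + of_int Z * r^3"
    by (simp add: algebra_simps power2_eq_square power3_eq_cube)
  also have "\<dots> = ev r (mult_root a b t)"
    unfolding root_cube fields by (simp add: mult_root_def algebra_simps)
  finally show ?thesis by (simp add: fields)
qed

lemma ev_mult_shift: "ev r (mult_shift a b c t) = (r - of_int c) * ev r t"
proof -
  obtain U V W where m: "mult_root a b t = (U, V, W)" by (metis prod_cases3)
  obtain X Y Z where t: "t = (X, Y, Z)" by (metis prod_cases3)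
  have "ev r (mult_shift a b c t) = ev r (mult_root a b t) - of_int c * ev r t"
    unfolding mult_shift_def m unfolding t by (simp add: algebra_simps)
  then show ?thesis by (simp add: ev_mult_root algebra_simps)
qed

lemma ev_mult_ratio: "ev r (mult_ratio a b t) = (1 + of_int (b - a) * r * (r - of_int a)) * ev r t"
proof -
  obtain U V W where m: "mult_root a b (mult_shift a b a t) = (U, V, W)" by (metis prod_cases3)
  obtain X Y Z where t: "t = (X, Y, Z)" by (metis prod_cases3)
  have "ev r (mult_ratio a b t) = ev r t + of_int (b - a) * ev r (mult_root a b (mult_shift a b a t))"
    unfolding mult_ratio_def m unfolding t by (simp add: algebra_simps)
  then show ?thesis by (simp add: ev_mult_root ev_mult_shift algebra_simps)
qed

text \<open>Since \<open>r * (r - a)\<close> is the inverse of \<open>r - b\<close>, the first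
  factor is \<open>1 + (b - a) / (r - b)\<close>.\<close>

lemma ratio_unit: "(1 + of_int (b - a) * r * (r - of_int a)) * (r - of_int b) = r - of_int a"
proof -
  have "(1 + of_int (b - a) * r * (r - of_int a)) * (r - of_int b)
      = r - of_int b + of_int (b - a) * (r * (r - of_int a) * (r - of_int b))"
    by (simp add: algebra_simps)
  then show ?thesis by (simp add: root)
qed

end

lemma prod_ev_symmetric:
  fixes r1 r2 r3 :: "'a::comm_ring_1"
  assumes "e1 = r1 + r2 + r3" "e2 = r1 * r2 + r1 * r3 + r2 * r3" "e3 = r1 * r2 * r3"
  shows "(X + Y * r1 + Z * r1^2) * (X + Y * r2 + Z * r2^2) * (X + Y * r3 + Z * r3^2) =
     X^3 + X^2 * Y * e1 + X^2 * Z * (e1^2 - 2 * e2) + X * Y^2 * e2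
     + X * Y * Z * (e1 * e2 - 3 * e3) + X * Z^2 * (e2^2 - 2 * e1 * e3)
     + Y^3 * e3 + Y^2 * Z * (e1 * e3) + Y * Z^2 * (e2 * e3) + Z^3 * e3^2"
  unfolding assms by (simp add: algebra_simps power2_eq_square power3_eq_cube)

text \<open>Differences of the equations are divisible by differences of the roots. Two such
  divisions isolate \<open>p\<close>; back substitution gives \<open>q\<close> and
  \<open>s\<close>.\<close>

lemma vieta_cubic:
  fixes r1 r2 r3 :: "'a::idom"
  assumes "r1 \<noteq> r2" "r1 \<noteq> r3" "r2 \<noteq> r3"
    and "r1^3 - p * r1^2 + q * r1 - s = 0" "r2^3 - p * r2^2 + q * r2 - s = 0"
      "r3^3 - p * r3^2 + q * r3 - s = 0"
  shows "p = r1 + r2 + r3" "q = r1 * r2 + r1 * r3 + r2 * r3" "s = r1 * r2 * r3"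
proof -
  have "(r1 - r2) * (r1^2 + r1 * r2 + r2^2 - p * (r1 + r2) + q) = 0"
    using assms(4,5) by algebra
  then have 12: "r1^2 + r1 * r2 + r2^2 - p * (r1 + r2) + q = 0"
    using assms(1) by simp
  have "(r1 - r3) * (r1^2 + r1 * r3 + r3^2 - p * (r1 + r3) + q) = 0"
    using assms(4,6) by algebra
  then have 13: "r1^2 + r1 * r3 + r3^2 - p * (r1 + r3) + q = 0"
    using assms(2) by simp
  have "(r2 - r3) * (r1 + r2 + r3 - p) = 0"
    using 12 13 by algebra
  then show p: "p = r1 + r2 + r3"
    using assms(3) by simp
  show q: "q = r1 * r2 + r1 * r3 + r2 * r3"
    using 12 unfolding p by algebra
  show "s = r1 * r2 * r3"
    using assms(4) unfolding p q by algebra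
qed

section \<open>Location of the real roots, signatures and multiplication by units\<close>

locale cubic_roots =
  fixes a b :: int and r1 r2 r3 :: real
  assumes a: "2 \<le> a" and ab: "a + 2 \<le> b"
    and root: "r1 * (r1 - a) * (r1 - b) = 1" "r2 * (r2 - a) * (r2 - b) = 1"
      "r3 * (r3 - a) * (r3 - b) = 1"
    and r1: "0 < r1" "r1 * a < 1" and r2: "a - 1 < r2" "r2 < a" and r3: "b < r3"
begin

lemma order: "r1 < 1" "1 < r2" "r2 < r3" "r1 < r2" "r1 < r3" "r1 < a" "r1 < b" "r2 < b" "a < r3"
proof -
  have "2 * r1 \<le> r1 * a"
    using r1(1) a by simp
  then show 1: "r1 < 1"
    using r1 by linarith
  show 2: "1 < r2" "r2 < r3" "r2 < b" "a < r3"
    using r2 r3 a ab by linarith+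
  show "r1 < r2" "r1 < r3" "r1 < a" "r1 < b"
    using 1 2 r2 r3 by linarith+
qed

lemma vieta: "a + b = r1 + r2 + r3" "a * b = r1 * r2 + r1 * r3 + r2 * r3" "1 = r1 * r2 * r3"
proof -
  have "r^3 - (a + b) * r^2 + (a * b) * r - 1 = 0" if "r * (r - a) * (r - b) = 1" for r :: real
    using that by (simp add: algebra_simps power2_eq_square power3_eq_cube)
  from vieta_cubic[OF _ _ _ this[OF root(1)] this[OF root(2)] this[OF root(3)]]
  show "a + b = r1 + r2 + r3" "a * b = r1 * r2 + r1 * r3 + r2 * r3" "1 = r1 * r2 * r3"
    using order by auto
qed

lemma prod_ev: "ev r1 t * ev r2 t * ev r3 t = cubic_norm a b t"
proof (cases t)
  case (fields X Y Z)
  show ?thesis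
    unfolding fields ev_simp prod_ev_symmetric[OF vieta] by (simp add: cubic_norm_def)
qed

definition signed :: "int \<times> int \<times> int \<Rightarrow> bool" where
  "signed t \<longleftrightarrow> ev r1 t < 0 \<and> ev r2 t < 0 \<and> 0 < ev r3 t"

definition signed_indec :: "int \<times> int \<times> int \<Rightarrow> bool" where
  "signed_indec t \<longleftrightarrow> signed t \<and> (\<forall>u v. signed u \<longrightarrow> signed v \<longrightarrow> t \<noteq> u + v)"

text \<open>A decomposition of \<open>\<phi> t\<close> would be carried back by
  \<open>\<psi>\<close> to one of \<open>t\<close>. Applied with \<open>\<phi>\<close> and
  \<open>\<psi>\<close> mutually inverse multiplications by totally positive units.\<close>

lemma signed_indec_map:
  assumes "\<And>u v. \<psi> (u + v) = \<psi> u + \<psi> v" "\<And>u. signed (\<psi> u) \<longleftrightarrow> signed u" "\<psi> (\<phi> t) = t" "signed_indec t"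
  shows "signed_indec (\<phi> t)"
  unfolding signed_indec_def
proof (intro conjI allI impI notI)
  show "signed (\<phi> t)"
    using assms(2)[of "\<phi> t"] assms(3,4) by (simp add: signed_indec_def)
  fix u v assume "signed u" "signed v" "\<phi> t = u + v"
  then have "signed (\<psi> u)" "signed (\<psi> v)" "t = \<psi> u + \<psi> v"
    using assms(1)[of u v] assms(2)[of u] assms(2)[of v] assms(3) by simp_all
  then show False
    using assms(4) unfolding signed_indec_def by blast
qed

lemma signed_mult_root: "signed (mult_root a b t) \<longleftrightarrow> signed t"
  using r1 order unfolding signed_def ev_mult_root[OF root(1)] ev_mult_root[OF root(2)] ev_mult_root[OF root(3)]
  by (auto simp: mult_less_0_iff zero_less_mult_iff)

lemma signed_div_root: "signed (div_root a b t) \<longleftrightarrow> signed t"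
  using signed_mult_root[of "div_root a b t"] by simp

text \<open>All three roots are positive, so \<open>(r - a) * (r - b) = 1 / r\<close> is positive
  and the quotient of these two factors is too.\<close>

lemma ratio_pos: "0 < 1 + real_of_int (b - a) * r * (r - a)" if "r \<in> {r1, r2, r3}" for r
proof -
  have "r * (r - a) * (r - b) = 1" "(r - a) * (r - b) > 0"
    using that root order r2 r3 by (auto simp: zero_less_mult_iff)
  with ratio_unit[of r a b] show ?thesis
    by (smt (verit) mult_nonneg_nonneg mult_nonpos_nonneg mult_nonneg_nonpos zero_less_mult_iff mult_nonpos_nonpos)
qed

lemma signed_mult_ratio: "signed (mult_ratio a b t) \<longleftrightarrow> signed t"
  using ratio_pos[of r1] ratio_pos[of r2] ratio_pos[of r3]
  unfolding signed_def ev_mult_ratio[OF root(1)] ev_mult_ratio[OF root(2)] ev_mult_ratio[OF root(3)]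
  by (auto simp: mult_less_0_iff zero_less_mult_iff)

lemma signed_div_ratio: "signed (mult_ratio b a t) \<longleftrightarrow> signed t"
  using signed_mult_ratio[of "mult_ratio b a t"] by (simp add: mult_ratio_inverse)

lemma norm_mult_root: "cubic_norm a b (mult_root a b t) = cubic_norm a b t"
proof -
  have "real_of_int (cubic_norm a b (mult_root a b t)) = (r1 * r2 * r3) * (ev r1 t * ev r2 t * ev r3 t)"
    unfolding prod_ev[symmetric] by (simp add: ev_mult_root root)
  then show ?thesis
    unfolding vieta(3)[symmetric] prod_ev by simp
qed

lemma norm_div_root: "cubic_norm a b (div_root a b t) = cubic_norm a b t"
  using norm_mult_root[of "div_root a b t"] by simp

text \<open>The polynomial \<open>x * (x - a) * (x - b) - 1\<close> takes the value -1 at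
  \<open>a\<close> and at \<open>b\<close>, so the units \<open>r - a\<close> and
  \<open>r - b\<close> have norm 1.\<close>

lemma prod_shift:
  "(r1 - a) * (r2 - a) * (r3 - a) = 1" "(r1 - b) * (r2 - b) * (r3 - b) = 1"
  using vieta unfolding of_int_add of_int_mult by algebra+

lemma norm_mult_shift: "cubic_norm a b (mult_shift a b b t) = cubic_norm a b t"
proof -
  have "real_of_int (cubic_norm a b (mult_shift a b b t))
      = ((r1 - b) * (r2 - b) * (r3 - b)) * (ev r1 t * ev r2 t * ev r3 t)"
    unfolding prod_ev[symmetric] by (simp add: ev_mult_shift root)
  then show ?thesis
    unfolding prod_shift prod_ev by simp
qed

lemma norm_mult_ratio: "cubic_norm a b (mult_ratio a b t) = cubic_norm a b t"
proof -
  define \<eta> where "\<eta> r = 1 + real_of_int (b - a) * r * (r - a)" for r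
  have "(\<eta> r1 * \<eta> r2 * \<eta> r3) * ((r1 - b) * (r2 - b) * (r3 - b)) = (r1 - a) * (r2 - a) * (r3 - a)"
    using ratio_unit[OF root(1)] ratio_unit[OF root(2)] ratio_unit[OF root(3)]
    unfolding \<eta>_def by algebra
  then have \<eta>: "\<eta> r1 * \<eta> r2 * \<eta> r3 = 1"
    unfolding prod_shift by simp
  have "real_of_int (cubic_norm a b (mult_ratio a b t))
      = (\<eta> r1 * \<eta> r2 * \<eta> r3) * (ev r1 t * ev r2 t * ev r3 t)"
    unfolding prod_ev[symmetric] \<eta>_def by (simp add: ev_mult_ratio root)
  then show ?thesis
    unfolding \<eta> prod_ev by simp
qed

lemma norm_div_ratio: "cubic_norm a b (mult_ratio b a t) = cubic_norm a b t"
  using norm_mult_ratio[of "mult_ratio b a t"] by (simp add: mult_ratio_inverse)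

end

section \<open>The two cones\<close>

context cubic_roots
begin

text \<open>Interpolation writes each functional as a combination of the three conjugate values; the
  bounds on the roots make the signs of the coefficients agree with the signature.\<close>

lemma levels_pos:
  assumes "signed (X, Y, Z)"
  shows "0 < Y + (b + 1) * Z" "0 < a * Z - X"
proof -
  define p where "p r = X + Y * r + Z * r^2" for r :: real
  have p: "p r1 < 0" "p r2 < 0" "0 < p r3"
    using assms by (simp_all add: signed_def p_def)
  have V: "(r2 - r1) * (r3 - r1) * (r3 - r2) > 0"
    using order by simp
  \<comment> \<open>Lagrange interpolation, multiplied by the Vandermonde determinant of the
    roots.\<close>
  have interpolation:
    "(r2 - r1) * (r3 - r1) * (r3 - r2) * Z =
       (r3 - r2) * p r1 - (r3 - r1) * p r2 + (r2 - r1) * p r3"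
    "(r2 - r1) * (r3 - r1) * (r3 - r2) * Y =
       - (r3 - r2) * (r2 + r3) * p r1 + (r3 - r1) * (r1 + r3) * p r2 - (r2 - r1) * (r1 + r2) * p r3"
    "(r2 - r1) * (r3 - r1) * (r3 - r2) * X =
       (r3 - r2) * (r2 * r3) * p r1 - (r3 - r1) * (r1 * r3) * p r2 + (r2 - r1) * (r1 * r2) * p r3"
    unfolding p_def by algebra+
  have "(r2 - r1) * (r3 - r1) * (r3 - r2) * (Y + (b + 1) * Z) =
      (r3 - r2) * ((b + 1) - (r2 + r3)) * p r1 - (r3 - r1) * ((b + 1) - (r1 + r3)) * p r2
      + (r2 - r1) * ((b + 1) - (r1 + r2)) * p r3"
    using interpolation(1,2) unfolding of_int_add of_int_diff of_int_mult of_int_1 by algebra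
  moreover have "0 \<le> (r3 - r2) * ((b + 1) - (r2 + r3)) * p r1"
    using p order r2 r3 a by (intro mult_nonpos_nonpos mult_nonneg_nonpos) auto
  \<comment> \<open>As \<open>r1 + r3 = a + b - r2\<close>, the middle factor is
    \<open>r2 - (a - 1)\<close>; this is where the lower bound on \<open>r2\<close> enters.\<close>
  moreover have "(r3 - r1) * ((b + 1) - (r1 + r3)) * p r2 < 0"
    using p order r2 r3 vieta(1) by (intro mult_pos_neg mult_pos_pos) auto
  moreover have "0 < (r2 - r1) * ((b + 1) - (r1 + r2)) * p r3"
    using p order r2 ab by (intro mult_pos_pos) auto
  ultimately have "0 < (r2 - r1) * (r3 - r1) * (r3 - r2) * (Y + (b + 1) * Z)"
    by linarith
  then have "0 < real_of_int (Y + (b + 1) * Z)"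
    using V by (simp add: zero_less_mult_iff)
  then show "0 < Y + (b + 1) * Z"
    by linarith
  have "(r2 - r1) * (r3 - r1) * (r3 - r2) * (a * Z - X) =
      (r3 - r2) * (a - r2 * r3) * p r1 - (r3 - r1) * (a - r1 * r3) * p r2
      + (r2 - r1) * (a - r1 * r2) * p r3"
    using interpolation(1,3) unfolding of_int_add of_int_diff of_int_mult of_int_1 by algebra
  moreover have "0 < (r3 - r2) * (a - r2 * r3) * p r1"
  proof -
    have "1 * r3 < r2 * r3"
      using order r1 by (intro mult_strict_right_mono) auto
    then show ?thesis
      using p order by (intro mult_neg_neg mult_pos_neg) linarith+
  qed
  moreover have "(r3 - r1) * (a - r1 * r3) * p r2 < 0"
  proof -
    have "r1 * r3 * 1 < r1 * r3 * r2"
      using order r1 by (intro mult_strict_left_mono mult_pos_pos) auto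
    then have "r1 * r3 < 1"
      using vieta(3) by (simp add: ac_simps)
    then show ?thesis
      using p order a by (intro mult_pos_neg mult_pos_pos) auto
  qed
  moreover have "0 < (r2 - r1) * (a - r1 * r2) * p r3"
  proof -
    have "r1 * r2 < 1 * r2"
      using order by (intro mult_strict_right_mono) auto
    then show ?thesis
      using p order r2 by (intro mult_pos_pos) linarith+
  qed
  ultimately have "0 < (r2 - r1) * (r3 - r1) * (r3 - r2) * (a * Z - X)"
    by linarith
  then have "0 < real_of_int (a * Z - X)"
    using V by (simp add: zero_less_mult_iff)
  then show "0 < a * Z - X"
    by linarith
qed

text \<open>Facet inequalities of the cone spanned by \<open>r - a\<close>, \<open>r - b\<close> and
  \<open>r * (r - b)\<close>. Up to positive factors the three expressions are, with sign, the
  coordinates along these generators.\<close>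

definition cone1 :: "int \<times> int \<times> int \<Rightarrow> bool" where
  "cone1 = (\<lambda>(X, Y, Z). 0 \<le> Z \<and> X + a * (Y + b * Z) \<le> 0 \<and> 0 \<le> X + b * (Y + b * Z))"

text \<open>Likewise for the generators \<open>r - a\<close>, \<open>r * (r - a)\<close> and
  \<open>r * (r - b)\<close>, on the other side of the diagonal.\<close>

definition cone2 :: "int \<times> int \<times> int \<Rightarrow> bool" where
  "cone2 = (\<lambda>(X, Y, Z). X \<le> 0 \<and> X + a * (Y + a * Z) \<le> 0 \<and> 0 \<le> X + a * (Y + b * Z))"

lemma generators: "signed (- a, 1, 0)" "signed (- b, 1, 0)" "signed (0, - a, 1)" "signed (0, - b, 1)"
proof -
  have *: "r * (r - c) = real_of_int 0 + of_int (- c) * r + of_int 1 * r^2"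
    for r :: real and c :: int
    by (simp add: algebra_simps power2_eq_square)
  show "signed (- a, 1, 0)" "signed (- b, 1, 0)"
    using order r2 r3 by (simp_all add: signed_def)
  show "signed (0, - a, 1)" "signed (0, - b, 1)"
    unfolding signed_def ev_simp *[symmetric]
    using order r1 r2 r3 by (auto simp: mult_less_0_iff zero_less_mult_iff)
qed

text \<open>Elements of the given signature form a convex cone. The factor \<open>m\<close> clears
  the denominators of the coordinates along the generators.\<close>

lemma signed_combination:
  assumes "0 < m" "0 \<le> x" "0 \<le> y" "0 \<le> z" "x \<noteq> 0 \<or> y \<noteq> 0 \<or> z \<noteq> 0" "signed s" "signed t" "signed u"
    and ev: "\<And>r::real. of_int m * ev r v = of_int x * ev r s + of_int y * ev r t + of_int z * ev r u"
  shows "signed v"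
proof -
  have neg: "of_int x * p + of_int y * q + of_int z * w < 0" if "p < 0" "q < 0" "w < 0" for p q w :: real
  proof -
    have "of_int x * p \<le> 0" "of_int y * q \<le> 0" "of_int z * w \<le> 0"
      using assms(2-4) that by (auto intro: mult_nonneg_nonpos)
    moreover have "of_int x * p < 0 \<or> of_int y * q < 0 \<or> of_int z * w < 0"
      using assms(2-5) that by (auto simp: mult_less_0_iff)
    ultimately show ?thesis by linarith
  qed
  have "of_int m * ev r1 v < 0" "of_int m * ev r2 v < 0"
    unfolding ev using assms(6-8) by (auto intro!: neg simp: signed_def)
  moreover have "0 < of_int m * ev r3 v"
    unfolding ev using neg[of "- ev r3 s" "- ev r3 t" "- ev r3 u"] assms(6-8) by (simp add: signed_def)
  ultimately show ?thesis
    using assms(1) by (simp add: signed_def mult_less_0_iff zero_less_mult_iff)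
qed

lemma cone1_signed:
  assumes c: "cone1 t" and nz: "t \<noteq> (0, 0, 0)"
  shows "signed t"
proof -
  obtain X Y Z where t: "t = (X, Y, Z)" by (metis prod_cases3)
  show ?thesis
  proof (rule signed_combination[OF _ _ _ _ _ generators(1,2,4)])
    show "0 < b - a" "0 \<le> X + b * (Y + b * Z)" "0 \<le> - (X + a * (Y + b * Z))" "0 \<le> (b - a) * Z"
      using c ab by (auto simp: t cone1_def)
    show "X + b * (Y + b * Z) \<noteq> 0 \<or> - (X + a * (Y + b * Z)) \<noteq> 0 \<or> (b - a) * Z \<noteq> 0"
    proof (rule ccontr)
      assume "\<not> ?thesis"
      then have e: "X + b * (Y + b * Z) = 0" "X + a * (Y + b * Z) = 0" "Z = 0"
        using ab by auto
      then have "(b - a) * Y = 0"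
        by algebra
      then show False
        using e nz ab by (simp add: t)
    qed
    fix r :: real
    show "of_int (b - a) * ev r t = of_int (X + b * (Y + b * Z)) * ev r (- a, 1, 0)
      + of_int (- (X + a * (Y + b * Z))) * ev r (- b, 1, 0) + of_int ((b - a) * Z) * ev r (0, - b, 1)"
      unfolding t ev_simp by (simp add: algebra_simps)
  qed
qed

lemma cone2_signed:
  assumes c: "cone2 t" and nz: "t \<noteq> (0, 0, 0)"
  shows "signed t"
proof -
  obtain X Y Z where t: "t = (X, Y, Z)" by (metis prod_cases3)
  show ?thesis
  proof (rule signed_combination[OF _ _ _ _ _ generators(1,3,4)])
    show "0 < a * (b - a)" "0 \<le> (b - a) * (- X)"
      "0 \<le> X + a * (Y + b * Z)" "0 \<le> - (X + a * (Y + a * Z))"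
      using c a ab by (auto simp: t cone2_def mult_nonneg_nonpos)
    show "(b - a) * (- X) \<noteq> 0 \<or> X + a * (Y + b * Z) \<noteq> 0 \<or> - (X + a * (Y + a * Z)) \<noteq> 0"
    proof (rule ccontr)
      assume "\<not> ?thesis"
      then have e: "X = 0" "Y + b * Z = 0" "Y + a * Z = 0"
        using a ab by auto
      then have "(b - a) * Z = 0"
        by algebra
      then show False
        using e nz ab by (simp add: t)
    qed
    fix r :: real
    show "of_int (a * (b - a)) * ev r t = of_int ((b - a) * (- X)) * ev r (- a, 1, 0)
      + of_int (X + a * (Y + b * Z)) * ev r (0, - a, 1)
      + of_int (- (X + a * (Y + a * Z))) * ev r (0, - b, 1)"
      unfolding t ev_simp by (simp add: algebra_simps)
  qed
qed

section \<open>Reduction to one of the two cones by minimal level\<close>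

definition level :: "int \<times> int \<times> int \<Rightarrow> int" where
  "level = (\<lambda>(X, Y, Z). min (a * (Y + (b + 1) * Z)) (a * Z - X))"

lemma level_pos: "signed t \<Longrightarrow> 0 < level t"
  using levels_pos a by (cases t) (simp add: level_def)

text \<open>The two functionals in \<open>level\<close> equal \<open>a\<close> on the generators of \<open>cone1\<close> and \<open>cone2\<close>
  respectively. Comparing the minimum with the functional of the cone across one facet shows that
  the coefficient of the generator opposite to this facet is nonnegative.\<close>

lemma cone_of_level_minimal:
  assumes "level t \<le> level (mult_root a b t)" "level t \<le> level (div_root a b t)"
    "level t \<le> level (mult_ratio a b t)" "level t \<le> level (mult_ratio b a t)"
  shows "cone1 t \<or> cone2 t"
proof -
  obtain X Y Z where t: "t = (X, Y, Z)" by (metis prod_cases3)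
  define m where "m = a * (b - a) - 1"
  have m: "0 < m" and a2: "0 < a * (a - 1) - 1"
  proof -
    have "2 * 2 \<le> a * (b - a)" "2 * 1 \<le> a * (a - 1)"
      using a ab by (intro mult_mono; simp)+
    then show "0 < m" "0 < a * (a - 1) - 1"
      by (simp_all add: m_def)
  qed
  show ?thesis
  \<comment> \<open>The functional attaining the minimum tells on which side of the diagonal
    \<open>t\<close> lies, which supplies one of the three facet inequalities.\<close>
  proof (cases "a * (Y + (b + 1) * Z) \<le> a * Z - X")
    case True
    then have l: "level t = a * (Y + (b + 1) * Z)"
      by (simp add: level_def t)
    \<comment> \<open>The root carries the edge \<open>(- a, 1, 0)\<close>,
      \<open>(- b, 1, 0)\<close> of \<open>cone1\<close> to the edge \<open>(0, - a, 1)\<close>,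
      \<open>(0, - b, 1)\<close> of \<open>cone2\<close>, so the image is measured by the second
      functional.\<close>
    have "level (mult_root a b t) \<le> a * (Y + (a + b) * Z) - Z"
      by (simp add: level_def t mult_root_def)
    then have "0 \<le> (a * (a - 1) - 1) * Z"
      using assms(1) l by (simp add: algebra_simps)
    then have 1: "0 \<le> Z"
      using a2 by (simp add: zero_le_mult_iff)
    \<comment> \<open>The ratio carries the edge \<open>(- b, 1, 0)\<close>,
      \<open>(0, - b, 1)\<close> to \<open>(- a, 1, 0)\<close>, \<open>(0, - a, 1)\<close>, again an
      edge of \<open>cone2\<close>.\<close>
    have "level (mult_ratio a b t) \<le> a * (Y + (b + 1) * Z) + m * (X + b * (Y + b * Z))"
      by (simp add: level_def t mult_ratio_def mult_shift_def mult_root_def m_def algebra_simps)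
    then have "0 \<le> m * (X + b * (Y + b * Z))"
      using assms(3) l by simp
    then have 2: "0 \<le> X + b * (Y + b * Z)"
      using m by (simp add: zero_le_mult_iff)
    show ?thesis
      using True 1 2 by (simp add: t cone1_def algebra_simps)
  next
    case False
    then have l: "level t = a * Z - X"
      by (simp add: level_def t)
    \<comment> \<open>Here the inverse units lead from the same edges of \<open>cone2\<close> back
      to \<open>cone1\<close>, so the first functional is used.\<close>
    have "level (div_root a b t) \<le> a * (Z - (a + b) * X + (b + 1) * X)"
      by (simp add: level_def t div_root_def)
    then have "(a * (a - 1) - 1) * X \<le> 0"
      using assms(2) l by (simp add: algebra_simps)
    then have 1: "X \<le> 0"
      using a2 by (simp add: mult_le_0_iff)
    have "level (mult_ratio b a t) \<le> a * Z - X - m * (X + a * (Y + a * Z))"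
      by (simp add: level_def t mult_ratio_def mult_shift_def mult_root_def m_def algebra_simps)
    then have "m * (X + a * (Y + a * Z)) \<le> 0"
      using assms(4) l by simp
    then have 2: "X + a * (Y + a * Z) \<le> 0"
      using m by (simp add: mult_le_0_iff)
    show ?thesis
      using False 1 2 by (simp add: t cone2_def algebra_simps)
  qed
qed

lemma signed_indec_reduce:
  assumes "signed_indec t"
  shows "\<exists>u. signed_indec u \<and> cubic_norm a b u = cubic_norm a b t \<and> (cone1 u \<or> cone2 u)"
proof -
  define P where "P u \<longleftrightarrow> signed_indec u \<and> cubic_norm a b u = cubic_norm a b t" for u
  \<comment> \<open>Levels of signed elements are positive integers, so \<open>nat\<close> keeps
    their order. All signed indecomposables of this norm compete; closure under the four unit
    multiplications yields the comparisons.\<close>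
  have "\<exists>u. P u \<and> (\<forall>v. P v \<longrightarrow> nat (level u) \<le> nat (level v))"
    using ex_has_least_nat[of P t "\<lambda>u. nat (level u)"] assms by (simp add: P_def)
  then obtain u where u: "P u" and min: "\<And>v. P v \<Longrightarrow> nat (level u) \<le> nat (level v)"
    by blast
  have le: "level u \<le> level v" if "P v" for v
    using min[OF that] level_pos[of v] that by (simp add: P_def signed_indec_def)
  note indec = u[unfolded P_def, THEN conjunct1]
  have "P (mult_root a b u)"
    using u signed_indec_map[where \<phi> = "mult_root a b" and \<psi> = "div_root a b",
        OF div_root_add signed_div_root div_mult_root indec] by (simp add: P_def norm_mult_root)
  moreover have "P (div_root a b u)"
    using u signed_indec_map[where \<phi> = "div_root a b" and \<psi> = "mult_root a b",
        OF mult_root_add signed_mult_root mult_div_root indec] by (simp add: P_def norm_div_root)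
  moreover have "P (mult_ratio a b u)"
    using u signed_indec_map[where \<phi> = "mult_ratio a b" and \<psi> = "mult_ratio b a",
        OF mult_ratio_add signed_div_ratio mult_ratio_inverse indec]
    by (simp add: P_def norm_mult_ratio)
  moreover have "P (mult_ratio b a u)"
    using u signed_indec_map[where \<phi> = "mult_ratio b a" and \<psi> = "mult_ratio a b",
        OF mult_ratio_add signed_mult_ratio mult_ratio_inverse indec]
    by (simp add: P_def norm_div_ratio)
  ultimately have "cone1 u \<or> cone2 u"
    by (intro cone_of_level_minimal le)
  with u show ?thesis
    unfolding P_def by blast
qed

section \<open>Indecomposable lattice points of the two cones\<close>

lemma signed_indec_subtract:
  assumes "signed_indec (X, Y, Z)" "signed (X', Y', Z')"
    and "cone1 (X - X', Y - Y', Z - Z') \<or> cone2 (X - X', Y - Y', Z - Z')"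
  shows "(X, Y, Z) = (X', Y', Z')"
proof (rule ccontr)
  assume ne: "\<not> ?thesis"
  \<comment> \<open>Nonzero lattice points of a cone are signed, so a nonzero difference would be a
    second summand.\<close>
  then have "signed (X - X', Y - Y', Z - Z')"
    using assms(3) cone1_signed cone2_signed by fastforce
  moreover have "(X, Y, Z) = (X', Y', Z') + (X - X', Y - Y', Z - Z')"
    by simp
  ultimately show False
    using assms(1,2) unfolding signed_indec_def by blast
qed

lemma signed_segment:
  assumes "a \<le> c" "c \<le> b"
  shows "signed (- c, 1, 0)" "signed (0, - c, 1)"
proof -
  have "0 \<le> (b - a) * (b - c)" "0 \<le> a * (b - c)"
    using assms a ab by simp_all
  then show "signed (- c, 1, 0)" "signed (0, - c, 1)"
    using assms a by (auto intro!: cone1_signed[of "(- c, 1, 0)"] cone2_signed[of "(0, - c, 1)"] simp: cone1_def cone2_def algebra_simps)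
qed

text \<open>A point with \<open>Z > 0\<close> stays in the cone after subtracting
  \<open>(0, - b, 1)\<close>. For \<open>Z = 0\<close> a planar cone remains, from which some
  \<open>(- c, 1, 0)\<close> can be subtracted.\<close>

lemma cone1_indecomposable:
  assumes "signed_indec t" "cone1 t"
  obtains c where "a \<le> c" "c \<le> b" "t = (- c, 1, 0) \<or> t = (0, - c, 1)"
proof -
  obtain X Y Z where t: "t = (X, Y, Z)" by (metis prod_cases3)
  have Z: "0 \<le> Z" and 1: "X + a * (Y + b * Z) \<le> 0" and 2: "0 \<le> X + b * (Y + b * Z)"
    using assms(2) by (simp_all add: t cone1_def)
  show thesis
  proof (cases "Z = 0")
    case False
    then have "cone1 (X - 0, Y - - b, Z - 1)"
      using Z 1 2 by (simp add: cone1_def algebra_simps)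
    then have "t = (0, - b, 1)"
      using signed_indec_subtract[of X Y Z 0 "- b" 1] assms(1) generators(4) by (simp add: t)
    then show thesis
      using that[of b] ab by simp
  next
    case True
    have "0 \<le> (b - a) * Y"
      using 1 2 True by (simp add: algebra_simps)
    then have "0 \<le> Y"
      using ab by (simp add: zero_le_mult_iff)
    moreover have "Y \<noteq> 0"
    proof
      assume "Y = 0"
      then have "t = (0, 0, 0)"
        using 1 2 True by (simp add: t)
      then show False
        using assms(1) by (simp add: signed_indec_def signed_def)
    qed
    ultimately have Y: "1 \<le> Y" by linarith
    \<comment> \<open>The least \<open>c\<close> from \<open>a\<close> on for which the remainder
      satisfies the last inequality of \<open>cone1\<close>.\<close>
    define c where "c = max a (- X - b * (Y - 1))"
    have c: "a \<le> c" "c \<le> b"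
      using 2 True ab by (simp_all add: c_def algebra_simps)
    have "0 \<le> (b - a) * (Y - 1)"
      using ab Y by simp
    then have "cone1 (X - - c, Y - 1, Z - 0)"
      using 1 2 True by (auto simp: cone1_def c_def max_def algebra_simps)
    then have "t = (- c, 1, 0)"
      using signed_indec_subtract[of X Y Z "- c" 1 0] assms(1) signed_segment[OF c] by (simp add: t)
    then show thesis
      using that[of c] c by simp
  qed
qed

text \<open>Unless \<open>t\<close> is itself the point subtracted, subtracting
  \<open>(- a, 1, 0)\<close> rules out \<open>X \<le> - a\<close> and subtracting some
  \<open>(0, - c, 1)\<close> rules out \<open>Z \<ge> 2\<close>. The points left at
  \<open>Z = 1\<close> are listed.\<close>

lemma cone2_indecomposable:
  assumes "signed_indec t" "cone2 t"
  obtains c where "a \<le> c" "c \<le> b" "t = (- c, 1, 0) \<or> t = (0, - c, 1)"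
  | v W where "0 \<le> v" "v < b - a" "1 \<le> W" "W < a" "t = (- W, - (v + a), 1)"
proof -
  obtain X Y Z where t: "t = (X, Y, Z)" by (metis prod_cases3)
  \<comment> \<open>\<open>A\<close> and \<open>B\<close> are the unnormalised coordinates along
    \<open>(0, - a, 1)\<close> and \<open>(0, - b, 1)\<close>; their sum depends on \<open>Z\<close>
    only.\<close>
  define A where "A = X + a * (Y + b * Z)"
  define B where "B = - (X + a * (Y + a * Z))"
  have X: "X \<le> 0" and A: "0 \<le> A" and B: "0 \<le> B"
    using assms(2) by (simp_all add: t cone2_def A_def B_def)
  have AB: "A + B = a * (b - a) * Z"
    by (simp add: A_def B_def algebra_simps)
  then have "0 \<le> a * (b - a) * Z"
    using A B by linarith
  moreover have "0 < a * (b - a)"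
    using a ab by simp
  ultimately have Z: "0 \<le> Z"
    by (metis linorder_not_less mult_pos_neg)
  show thesis
  proof (cases "X \<le> - a")
    case True
    then have "cone2 (X - - a, Y - 1, Z - 0)"
      using A B by (simp add: cone2_def A_def B_def algebra_simps)
    then have "t = (- a, 1, 0)"
      using signed_indec_subtract[of X Y Z "- a" 1 0] assms(1) generators(1) by (simp add: t)
    then show thesis
      using that(1)[of a] ab by simp
  next
    case Xa: False
    have "Z \<noteq> 0"
    proof
      assume "Z = 0"
      then have "X + a * Y = 0"
        using A B by (simp add: A_def B_def)
      then have "X = a * (- Y)"
        by simp
      then have "a dvd X" ..
      then have "X = 0"
        using X Xa zdvd_not_zless[of "- X" a] by fastforce
      then have "t = (0, 0, 0)"
        using \<open>X + a * Y = 0\<close> \<open>Z = 0\<close> a by (simp add: t)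
      then show False
        using assms(1) by (simp add: signed_indec_def signed_def)
    qed
    have "Z = 1"
    proof (rule ccontr)
      assume "Z \<noteq> 1"
      with Z \<open>Z \<noteq> 0\<close> have "2 \<le> Z" by linarith
      \<comment> \<open>The least \<open>c\<close> from \<open>a\<close> on with
        \<open>a * (b - c) \<le> A\<close>, so that \<open>A\<close> stays nonnegative after the
        subtraction. Rounding costs less than \<open>a\<close>, and \<open>Z \<ge> 2\<close> makes
        \<open>A + B\<close> large enough to keep \<open>B\<close> nonnegative as well.\<close>
      define c where "c = max a (b - A div a)"
      have "0 \<le> A div a"
        using A a by (simp add: pos_imp_zdiv_nonneg_iff)
      then have c: "a \<le> c" "c \<le> b"
        using ab by (simp_all add: c_def)
      have div: "a * (A div a) \<le> A" "A - a < a * (A div a)"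
        using a mult_div_mod_eq[of a A] pos_mod_bound[of a A] pos_mod_sign[of a A] by linarith+
      have "a * (b - A div a) \<le> a * c"
        using a by (simp add: c_def)
      then have lower: "a * b - A \<le> a * c"
        using div(1) by (simp add: algebra_simps)
      have "2 * (a * (b - a)) \<le> A + B"
        using mult_left_mono[OF \<open>2 \<le> Z\<close>, of "a * (b - a)"] \<open>0 < a * (b - a)\<close>
        unfolding AB by (simp add: ac_simps)
      moreover have "a * 2 \<le> a * (b - a)"
        using a ab by simp
      ultimately have "a * (b - A div a) \<le> a * a + B"
        using div(2) a by (simp add: algebra_simps)
      then have "a * c \<le> a * a + B"
        using B by (simp add: c_def max_def)
      then have "cone2 (X - 0, Y - - c, Z - 1)"
        using X lower by (simp add: cone2_def A_def B_def algebra_simps)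
      then have "t = (0, - c, 1)"
        using signed_indec_subtract[of X Y Z 0 "- c" 1] assms(1) signed_segment[OF c] by (simp add: t)
      then show False
        using \<open>Z \<noteq> 1\<close> by (simp add: t)
    qed
    have lo: "X + a * (Y + a) \<le> 0" and hi: "0 \<le> X + a * (Y + b)"
      using A B by (simp_all add: A_def B_def \<open>Z = 1\<close>)
    have "a * (Y + a) < a * 1"
      using lo Xa by simp
    then have Ya: "Y + a \<le> 0"
      using a by (simp add: mult_less_cancel_left)
    show thesis
    proof (cases "X = 0")
      case True
      then have "0 \<le> Y + b"
        using hi a by (simp add: zero_le_mult_iff)
      then show thesis
        using that(1)[of "- Y"] Ya True by (simp add: t \<open>Z = 1\<close>)
    next
      case False
      then have "0 < a * (Y + b)"
        using hi X by linarith
      then have "0 < Y + b"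
        using a by (simp add: zero_less_mult_iff)
      then show thesis
        using that(2)[of "- Y - a" "- X"] Ya X Xa False by (simp add: t \<open>Z = 1\<close>)
    qed
  qed
qed

end

section \<open>Norm inequalities\<close>

definition face_norm :: "int \<Rightarrow> int \<Rightarrow> int \<Rightarrow> int \<Rightarrow> int" where
  "face_norm a b v W = cubic_norm a b (- W, - (v + a), 1)"

text \<open>Multiplying \<open>r^2 - (v + a) * r - W\<close> by the unit \<open>r * (r - b)\<close>
  and using \<open>r^2 * (r - b) = a * r * (r - b) + 1\<close> gives the triple on the left. The
  equality of norms is checked as a polynomial identity.\<close>

lemma cubic_norm_alpha:
  "cubic_norm a b (- v, b * (a * v + W) + 1, - (a * v + W)) = face_norm a b v W"
  unfolding face_norm_def cubic_norm_def prod.case power_one mult_1_right by algebra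

text \<open>The norm of \<open>r - c\<close> is minus the value of the polynomial at
  \<open>c\<close>, and \<open>r\<close> has norm 1.\<close>

lemma cubic_norm_segment:
  "cubic_norm a b (- c, 1, 0) = c * (c - a) * (b - c) + 1"
  "cubic_norm a b (0, - c, 1) = c * (c - a) * (b - c) + 1"
  by (simp_all add: cubic_norm_def algebra_simps power2_eq_square power3_eq_cube)

text \<open>In each of the following inequalities the difference of the two sides, expressed in the
  distances of the parameters to their extreme values, has nonnegative coefficients.\<close>

lemma face_norm_Suc_height:
  assumes "0 \<le> v" "v + 2 \<le> b - a" "1 \<le> W" "W < a"
  shows "face_norm a b v W \<le> face_norm a b v (W + 1)"
proof -
  define w p e where "w = W - 1" and "p = a - W - 1" and "e = b - a - v - 2"
  have nonneg: "0 \<le> w" "0 \<le> p" "0 \<le> e"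
    using assms by (simp_all add: w_def p_def e_def)
  have W: "W = 1 + w" and a: "a = 2 + w + p" and b: "b = 4 + w + p + v + e"
    by (simp_all add: w_def p_def e_def)
  have "face_norm a b v (W + 1) - face_norm a b v W =
    e^2 * p * v + e^2 * v * w + e * p^2 * v + e * p * v^2 + 2 * e * p * v * w + e * v^2 * w
    + e * v * w^2 + 2 * e^2 * v + 2 * e^2 * w + 8 * e * p * v + 2 * e * p * w + 2 * e * v^2
    + 10 * e * v * w + 2 * e * w^2 + 2 * p^2 * v + 2 * p * v^2 + 2 * p * v * w + 2 * v^2 * w
    + 3 * e^2 + 3 * e * p + 15 * e * v + 15 * e * w + 9 * p * v + 4 * p * w + 4 * v^2 + 9 * v * w
    + w^2 + 20 * e + 7 * p + 15 * v + 14 * w + 23"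
    unfolding face_norm_def cubic_norm_def prod.case power_one mult_1_right W a b by algebra
  also have "\<dots> \<ge> 0"
    using nonneg assms(1) by simp
  finally show ?thesis by simp
qed

text \<open>Covers the column \<open>v = b - a - 1\<close>, outside the range of
  \<open>face_norm_Suc_height\<close>, by passing to the top of its neighbour.\<close>

lemma face_norm_last_column:
  assumes "a + 2 \<le> b" "1 \<le> W" "W + 2 \<le> a"
  shows "face_norm a b (b - a - 1) W \<le> face_norm a b (b - a - 2) (a - 1)"
proof -
  define w p e where "w = W - 1" and "p = a - W - 2" and "e = b - a - 2"
  have nonneg: "0 \<le> w" "0 \<le> p" "0 \<le> e"
    using assms by (simp_all add: w_def p_def e_def)
  have W: "W = 1 + w" and a: "a = 3 + w + p" and b: "b = 5 + w + p + e"
    by (simp_all add: w_def p_def e_def)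
  have "face_norm a b (b - a - 2) (a - 1) - face_norm a b (b - a - 1) W =
    2 * e^2 * p^2 + 3 * e^2 * p * w + e^2 * w^2 + e * p^3 + 2 * e * p^2 * w + 2 * e * p * w^2
    + e * w^3 + 9 * e^2 * p + 6 * e^2 * w + 14 * e * p^2 + 21 * e * p * w + 9 * e * w^2 + p^3
    + 2 * p^2 * w + p * w^2 + w^3 + 10 * e^2 + 46 * e * p + 33 * e * w + 12 * p^2 + 15 * p * w
    + 4 * w^2 + 40 * e + 35 * p + 15 * w + 22"
    unfolding face_norm_def cubic_norm_def prod.case power_one mult_1_right W a b by algebra
  also have "\<dots> \<ge> 0"
    using nonneg by simp
  finally show ?thesis by simp
qed

lemma face_norm_Suc_column:
  assumes "2 \<le> a" "0 \<le> v" "2 * v + 3 \<le> b - a"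
  shows "face_norm a b v (a - 1) \<le> face_norm a b (v + 1) (a - 1)"
proof -
  define p e where "p = a - 2" and "e = b - a - 2 * v - 3"
  have nonneg: "0 \<le> p" "0 \<le> e"
    using assms by (simp_all add: p_def e_def)
  have a: "a = 2 + p" and b: "b = 5 + p + 2 * v + e"
    by (simp_all add: p_def e_def)
  have "face_norm a b (v + 1) (a - 1) - face_norm a b v (a - 1) =
    e^2 * p^2 + e * p^3 + 2 * e * p^2 * v + 3 * e^2 * p + 9 * e * p^2 + 6 * e * p * v
    + 2 * p^2 * v + 2 * e^2 + 22 * e * p + 6 * e * v + 5 * p^2 + 8 * p * v + v^2 + 16 * e
    + 17 * p + 11 * v + 16"
    unfolding face_norm_def cubic_norm_def prod.case power_one mult_1_right a b by algebra
  also have "\<dots> \<ge> 0"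
    using nonneg assms(2) by simp
  finally show ?thesis by simp
qed

text \<open>The left side is the norm of \<open>r - c\<close> for \<open>c = a + v + 1\<close>, so
  inner edge points are dominated by the top of column \<open>v\<close>.\<close>

lemma segment_norm_le_face_norm:
  assumes "2 \<le> a" "0 \<le> v" "v + 2 \<le> b - a"
  shows "(a + v + 1) * (v + 1) * (b - a - v - 1) + 1 \<le> face_norm a b v (a - 1)"
proof -
  define p e where "p = a - 2" and "e = b - a - v - 2"
  have nonneg: "0 \<le> p" "0 \<le> e"
    using assms by (simp_all add: p_def e_def)
  have a: "a = 2 + p" and b: "b = 4 + p + v + e"
    by (simp_all add: p_def e_def)
  have "face_norm a b v (a - 1) - ((a + v + 1) * (v + 1) * (b - a - v - 1) + 1) =
    e^2 * p^2 * v + e * p^3 * v + e * p^2 * v^2 + e^2 * p^2 + 3 * e^2 * p * v + e * p^3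
    + 10 * e * p^2 * v + 3 * e * p * v^2 + p^3 * v + 2 * p^2 * v^2 + 2 * e^2 * p + 2 * e^2 * v
    + 8 * e * p^2 + 22 * e * p * v + 2 * e * v^2 + p^3 + 12 * p^2 * v + 6 * p * v^2 + e^2
    + 14 * e * p + 11 * e * v + 10 * p^2 + 27 * p * v + 5 * v^2 + 5 * e + 21 * p + 15 * v + 10"
    unfolding face_norm_def cubic_norm_def prod.case power_one mult_1_right a b by algebra
  also have "\<dots> \<ge> 0"
    using nonneg assms(2) by simp
  finally show ?thesis by simp
qed

text \<open>By \<open>face_norm_Suc_column\<close> the top values grow with \<open>v\<close> as long
  as \<open>v\<close> lies below the lower end of the interval, so \<open>v\<close> can be moved up
  into it.\<close>

lemma face_norm_top_bound:
  assumes "2 \<le> a" "0 \<le> v" "v < b - a"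
  shows "\<exists>v'\<in>{(b - a - 1) div 2..b - a - 1}. face_norm a b v (a - 1) \<le> face_norm a b v' (a - 1)"
  using assms(2,3)
proof (induction "nat (b - a - v)" arbitrary: v rule: less_induct)
  case less
  show ?case
  proof (cases "(b - a - 1) div 2 \<le> v")
    case True
    then show ?thesis
      using less.prems by (intro bexI[of _ v]) auto
  next
    case False
    then have v: "2 * v + 3 \<le> b - a"
      by linarith
    then obtain v' where "v' \<in> {(b - a - 1) div 2..b - a - 1}"
      "face_norm a b (v + 1) (a - 1) \<le> face_norm a b v' (a - 1)"
      using less.hyps[of "v + 1"] less.prems by auto
    then show ?thesis
      using face_norm_Suc_column[OF assms(1) less.prems(1) v] order_trans by blast
  qed
qed

text \<open>First \<open>W\<close> is raised to \<open>a - 1\<close>, with a change of column if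
  \<open>v\<close> is the last one; then \<open>v\<close> is moved into the upper half.\<close>

lemma face_norm_bound:
  assumes "a + 2 \<le> b" "0 \<le> v" "v < b - a" "1 \<le> W" "W < a"
  shows "\<exists>v'\<in>{(b - a - 1) div 2..b - a - 1}. face_norm a b v W \<le> face_norm a b v' (a - 1)"
proof -
  have a: "2 \<le> a" using assms by linarith
  have "\<exists>u. 0 \<le> u \<and> u < b - a \<and> face_norm a b v W \<le> face_norm a b u (a - 1)"
  proof (cases "v + 2 \<le> b - a")
    case True
    have "W \<le> W' \<longrightarrow> W' \<le> a - 1 \<longrightarrow> face_norm a b v W \<le> face_norm a b v W'" if "W \<le> W'" for W'
      using that
    proof (induction W' rule: int_ge_induct)
      case (step W')
      then show ?case
        using face_norm_Suc_height[OF assms(2) True, of W'] assms(4) by fastforce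
    qed simp
    then show ?thesis
      using assms by (intro exI[of _ v]) auto
  next
    case False
    then have v: "v = b - a - 1" using assms by linarith
    show ?thesis
    proof (cases "W + 2 \<le> a")
      case True
      then show ?thesis
        using face_norm_last_column[OF assms(1,4)] assms(1)
        by (intro exI[of _ "b - a - 2"]) (simp add: v)
    next
      case False
      then have "W = a - 1" using assms by linarith
      then show ?thesis
        using assms by (intro exI[of _ v]) simp
    qed
  qed
  then show ?thesis
    using face_norm_top_bound[OF a] order_trans by blast
qed

text \<open>The end points \<open>c = a\<close> and \<open>c = b\<close> have norm 1, which column 0
  dominates; any other \<open>c\<close> belongs to column \<open>c - a - 1\<close>.\<close>

lemma segment_norm_bound:
  assumes "2 \<le> a" "a + 2 \<le> b" "a \<le> c" "c \<le> b"
  shows "\<exists>v\<in>{(b - a - 1) div 2..b - a - 1}. c * (c - a) * (b - c) + 1 \<le> face_norm a b v (a - 1)"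
proof -
  have "\<exists>u. 0 \<le> u \<and> u < b - a \<and> c * (c - a) * (b - c) + 1 \<le> face_norm a b u (a - 1)"
  proof (cases "c = a \<or> c = b")
    case True
    have "(a + 1) * (b - a - 1) + 1 \<le> face_norm a b 0 (a - 1)"
      using segment_norm_le_face_norm[of a 0 b] assms by simp
    moreover have "0 \<le> (a + 1) * (b - a - 1)"
      using assms by simp
    ultimately have "1 \<le> face_norm a b 0 (a - 1)"
      by linarith
    then show ?thesis
      using True assms by (intro exI[of _ 0]) auto
  next
    case False
    then show ?thesis
      using segment_norm_le_face_norm[of a "c - a - 1" b] assms
      by (intro exI[of _ "c - a - 1"]) auto
  qed
  then show ?thesis
    using face_norm_top_bound[OF assms(1)] order_trans by blast
qed

context cubic_roots
begin

lemma signed_indec_norm_bound: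
  assumes "signed_indec t"
  shows "\<exists>v\<in>{(b - a - 1) div 2..b - a - 1}. cubic_norm a b t \<le> face_norm a b v (a - 1)"
proof -
  have segment: ?thesis if "a \<le> c" "c \<le> b" "u = (- c, 1, 0) \<or> u = (0, - c, 1)"
    "cubic_norm a b u = cubic_norm a b t" for c u
    using segment_norm_bound[OF a ab that(1,2)] that(3,4) cubic_norm_segment[of a b c] by auto
  obtain u where u: "signed_indec u" "cubic_norm a b u = cubic_norm a b t" "cone1 u \<or> cone2 u"
    using signed_indec_reduce[OF assms] by blast
  from u(3) show ?thesis
  proof
    assume "cone1 u"
    with u(1) obtain c where "a \<le> c" "c \<le> b" "u = (- c, 1, 0) \<or> u = (0, - c, 1)"
      by (rule cone1_indecomposable)
    then show ?thesis
      using segment u(2) by blast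
  next
    assume "cone2 u"
    with u(1) show ?thesis
    proof (cases rule: cone2_indecomposable)
      case (1 c)
      then show ?thesis
        using segment u(2) by blast
    next
      case (2 v W)
      then show ?thesis
        using face_norm_bound[OF ab 2(1-4)] u(2) by (simp add: face_norm_def)
    qed
  qed
qed

end

section \<open>The cubic field\<close>

lemma cubic_poly_eq_0_iff:
  fixes x :: "'a::comm_ring_1"
  shows "x ^ 3 - of_int (a + b) * x ^ 2 + of_int (a * b) * x - 1 = 0 \<longleftrightarrow>
    x * (x - of_int a) * (x - of_int b) = 1"
proof -
  have "x ^ 3 - of_int (a + b) * x ^ 2 + of_int (a * b) * x - 1 =
    x * (x - of_int a) * (x - of_int b) - 1"
    by (simp add: algebra_simps power2_eq_square power3_eq_cube)
  then show ?thesis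
    by (simp only: right_minus_eq)
qed

text \<open>Intermediate values between the zeros 0, \<open>a\<close>, \<open>b\<close> of
  \<open>f\<close> and the points \<open>1 / a\<close>, \<open>a - 1\<close>, \<open>b + 1\<close>,
  where \<open>f\<close> is at least 1.\<close>

lemma cubic_roots_exist:
  fixes a b :: int
  assumes a: "2 \<le> a" and ab: "a + 2 \<le> b"
  obtains r1 r2 r3 where "cubic_roots a b r1 r2 r3"
proof -
  define f where "f x = x * (x - a) * (x - b)" for x :: real
  have cont: "continuous_on A f" for A
    unfolding f_def by (intro continuous_intros)
  have f0: "f 0 = 0" "f a = 0" "f b = 0"
    by (simp_all add: f_def)
  have a': "2 \<le> real_of_int a" and ab': "real_of_int a + 2 \<le> b"
    using a ab by linarith+
  have "1 \<le> f (1 / a)"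
  proof -
    have "1 / real_of_int a \<le> 1 / 2"
      using a' by (simp add: field_simps)
    then have "1 * (real_of_int b - 1) \<le> (real_of_int a - 1 / a) * (b - 1 / a)"
      using a' ab' by (intro mult_mono) linarith+
    moreover have "a \<le> real_of_int b - 1"
      using ab' by linarith
    ultimately have "a * (1 / real_of_int a) \<le> (a - 1 / a) * (b - 1 / a) * (1 / real_of_int a)"
      using a' by (intro mult_right_mono) auto
    moreover have "(a - y) * (b - y) * y = f y" for y :: real
      by (simp add: f_def algebra_simps)
    ultimately have "a * (1 / real_of_int a) \<le> f (1 / a)"
      by (simp only:)
    then show ?thesis
      using a' by simp
  qed
  then obtain r1 :: real where r1: "0 \<le> r1" "r1 \<le> 1 / a" "f r1 = 1"
    using IVT'[of f 0 1 "1 / a"] cont f0 a' by auto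
  have "1 * 2 \<le> (real_of_int a - 1) * (b - a + 1)"
    using a' ab' by (intro mult_mono) auto
  then have "1 < f (a - 1)"
    by (simp add: f_def algebra_simps)
  then obtain r2 :: real where r2: "a - 1 \<le> r2" "r2 \<le> a" "f r2 = 1"
    using IVT2'[of f "real_of_int a" 1 "real_of_int a - 1"] cont f0 by auto
  have "1 * 1 \<le> (real_of_int b + 1) * (b + 1 - a)"
    using a' ab' by (intro mult_mono) auto
  then have "1 \<le> f (b + 1)"
    by (simp add: f_def algebra_simps)
  then obtain r3 :: real where r3: "b \<le> r3" "f r3 = 1"
    using IVT'[of f "real_of_int b" 1 "real_of_int b + 1"] cont f0 by auto
  have "0 < r1" "r2 < a" "b < r3"
    using r1 r2 r3 f0 by (metis less_eq_real_def zero_neq_one)+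
  moreover have "a - 1 < r2"
    using r2 \<open>1 < f (a - 1)\<close> by (metis less_eq_real_def less_irrefl)
  moreover have "r1 * a < 1"
  proof -
    have "r1 * a \<le> 1"
      using r1(2) a' by (simp add: field_simps)
    \<comment> \<open>At \<open>1 / a\<close> the value of \<open>f\<close> is a product of a factor
      above 1 and a factor of at least 1, so it is not 1.\<close>
    moreover have "r1 * a \<noteq> 1"
    proof
      assume "r1 * a = 1"
      moreover have "f r1 = r1 * a * (a - r1) * ((b - r1) / a)"
        using a' by (simp add: f_def field_simps)
      ultimately have "(a - r1) * ((b - r1) / a) = 1"
        using r1(3) by simp
      moreover have "1 / real_of_int a \<le> 1 / 2"
        using a' by (simp add: field_simps)
      then have "1 < a - r1" "a \<le> b - r1"
        using r1(2) a' ab' by linarith+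
      then have "1 < a - r1" "1 \<le> (b - r1) / a"
        using a' by (simp_all add: le_divide_eq)
      then have "1 * 1 < (a - r1) * ((b - r1) / a)"
        by (intro mult_less_le_imp_less) auto
      ultimately show False by simp
    qed
    ultimately show ?thesis by simp
  qed
  ultimately have "cubic_roots a b r1 r2 r3"
    using a ab r1 r2 r3 by unfold_locales (simp_all add: f_def)
  then show thesis by (rule that)
qed

definition cubic_poly :: "int \<Rightarrow> int \<Rightarrow> rat poly" where
  "cubic_poly a b = [:- 1, of_int (a * b), - of_int (a + b), 1:]"

lemma rpoly_cubic_poly_eq_0_iff:
  "rpoly (cubic_poly a b) x = 0 \<longleftrightarrow> x * (x - of_int a) * (x - of_int b) = 1"
  unfolding cubic_poly_eq_0_iff[symmetric] cubic_poly_def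
  by (simp add: of_rat_minus of_rat_add of_rat_diff of_rat_mult algebra_simps power2_eq_square power3_eq_cube)

text \<open>A rational root is an integer \<open>m\<close>, and \<open>m\<close> and
  \<open>m - b\<close> divide 1. Both are then 1 or -1, which is impossible for
  \<open>b \<ge> 4\<close>.\<close>

lemma irreducible_cubic_poly:
  assumes "2 \<le> a" "a + 2 \<le> b"
  shows "irreducible (cubic_poly a b)"
proof (rule irreducible_cubic)
  show "degree (cubic_poly a b) = 3"
    by (simp add: cubic_poly_def)
  fix x :: rat
  show "poly (cubic_poly a b) x \<noteq> 0"
  proof
    assume x: "poly (cubic_poly a b) x = 0"
    have "algebraic_int x"
      using x by (intro algebraic_int.intros[of "cubic_poly a b"])
        (auto simp: cubic_poly_def coeff_pCons split: nat.splits)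
    then obtain m where m: "x = of_int m"
      using rational_algebraic_int_is_int[of x] by (auto elim!: Ints_cases simp: Rats_def)
    have "map_poly of_rat (cubic_poly a b) = cubic_poly a b"
      by (intro map_poly_idI) simp
    then have "of_int (m * (m - a) * (m - b)) = (of_int 1 :: rat)"
      using x rpoly_cubic_poly_eq_0_iff[of a b x] by (simp add: m)
    then have e: "m * (m - a) * (m - b) = 1"
      by (simp only: of_int_eq_iff)
    then have "m dvd 1" "m - a dvd 1" "m - b dvd 1"
      by (metis dvd_triv_left mult.assoc, metis dvd_triv_left mult.assoc mult.commute, metis dvd_triv_right)
    then have "\<bar>m\<bar> = 1" "\<bar>m - b\<bar> = 1"
      by simp_all
    then show False
      using assms by linarith
  qed
qed

lemma ev_eq_rpoly: "ev x (X, Y, Z) = rpoly [:of_int X, of_int Y, of_int Z:] x"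
  by (simp add: algebra_simps power2_eq_square)

text \<open>Horner's rule: each step multiplies by \<open>x\<close>, and \<open>mult_root\<close>
  reduces the cube with integer coefficients.\<close>

lemma order_adjoin_eq_range_ev:
  assumes "x * (x - of_int a) * (x - of_int b) = 1"
  shows "order_adjoin x = range (ev x)"
proof (intro equalityI subsetI)
  fix y assume "y \<in> order_adjoin x"
  then obtain p :: "int poly" where y: "y = poly (map_poly of_int p) x"
    by (auto simp: order_adjoin_def)
  show "y \<in> range (ev x)"
    unfolding y
  proof (induction p)
    case 0
    then show ?case
      by (auto intro!: image_eqI[of _ _ "(0, 0, 0)"])
  next
    case (pCons c p)
    then obtain t where t: "poly (map_poly of_int p) x = ev x t"
      by blast
    have "poly (map_poly of_int (pCons c p)) x = ev x ((c, 0, 0) + mult_root a b t)"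
      by (simp add: map_poly_pCons t ev_add ev_mult_root[OF assms])
    then show ?case by blast
  qed
next
  fix y assume "y \<in> range (ev x)"
  then obtain X Y Z where "y = ev x (X, Y, Z)" by auto
  then have "y = poly (map_poly of_int [:X, Y, Z:]) x"
    by (simp add: map_poly_pCons algebra_simps power2_eq_square)
  then show "y \<in> order_adjoin x"
    unfolding order_adjoin_def by blast
qed

section \<open>Total positivity and norm in terms of coordinates\<close>

locale cubic_field = cubic_roots +
  fixes \<rho> :: complex
  assumes \<rho>: "\<rho> * (\<rho> - of_int a) * (\<rho> - of_int b) = 1"
begin

lemma irreducible: "irreducible (cubic_poly a b)"
  using a ab by (rule irreducible_cubic_poly)

lemma root_\<rho>: "rpoly (cubic_poly a b) \<rho> = 0"
  using \<rho> by (simp add: rpoly_cubic_poly_eq_0_iff)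

lemma adjoin_embedding_ev:
  assumes "rpoly (cubic_poly a b) r = 0"
  shows "adjoin_embedding \<rho> r (ev \<rho> t) = ev r t"
proof (cases t)
  case (fields X Y Z)
  show ?thesis
    unfolding fields ev_eq_rpoly by (rule adjoin_embedding_rpoly[OF irreducible root_\<rho> assms])
qed

text \<open>Stated for \<open>of_real\<close> into a general field so that it serves both the real
  embeddings (positivity) and the complex ones (norm).\<close>

lemma roots_eq:
  fixes f :: "real \<Rightarrow> 'a::real_field"
  assumes f: "f = of_real"
  shows "{r. rpoly (cubic_poly a b) r = 0} = {f r1, f r2, f r3}"
proof -
  have "x * (x - of_int a) * (x - of_int b) = 1 \<longleftrightarrow> (x - f r1) * (x - f r2) * (x - f r3) = 0" for x
  proof -
    have "of_int a + of_int b = f r1 + f r2 + f r3"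
      "of_int a * of_int b = f r1 * f r2 + f r1 * f r3 + f r2 * f r3" "1 = f r1 * f r2 * f r3"
      using vieta[THEN arg_cong[where f = f]] by (simp_all add: f)
    then have "(x - f r1) * (x - f r2) * (x - f r3) = x * (x - of_int a) * (x - of_int b) - 1"
      by algebra
    then show ?thesis by simp
  qed
  then show ?thesis
    by (auto simp: rpoly_cubic_poly_eq_0_iff)
qed

lemma ev_in_field_adjoin: "ev \<rho> t \<in> field_adjoin \<rho>"
  by (cases t) (simp only: ev_eq_rpoly rpoly_in_field_adjoin)

lemma totally_positive_ev:
  "totally_positive (field_adjoin \<rho>) (ev \<rho> t) \<longleftrightarrow> 0 < ev r1 t \<and> 0 < ev r2 t \<and> 0 < ev r3 t"
proof -
  have R: "{r::real. rpoly (cubic_poly a b) r = 0} = {r1, r2, r3}"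
    using roots_eq[of "\<lambda>r. r"] by (simp add: fun_eq_iff)
  then have "rpoly (cubic_poly a b) r1 = 0" "rpoly (cubic_poly a b) r2 = 0"
    "rpoly (cubic_poly a b) r3 = 0"
    by blast+
  then show ?thesis
    unfolding totally_positive_def field_embeddings_adjoin[OF irreducible root_\<rho>] R
    by (simp add: ev_in_field_adjoin adjoin_embedding_ev)
qed

lemma field_norm_ev: "field_norm (field_adjoin \<rho>) (ev \<rho> t) = of_int (cubic_norm a b t)"
proof -
  let ?c = "complex_of_real"
  let ?R = "{r::complex. rpoly (cubic_poly a b) r = 0}"
  have R: "?R = {?c r1, ?c r2, ?c r3}"
    using roots_eq[of ?c] by simp
  have "(\<Prod>\<sigma>\<in>(field_embeddings (field_adjoin \<rho>) :: (complex \<Rightarrow> complex) set). \<sigma> (ev \<rho> t))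
      = (\<Prod>r\<in>?R. adjoin_embedding \<rho> r (ev \<rho> t))"
    unfolding field_embeddings_adjoin[OF irreducible root_\<rho>]
    by (subst prod.reindex[OF inj_on_adjoin_embedding[OF irreducible root_\<rho>]]) simp
  also have "\<dots> = (\<Prod>r\<in>?R. ev r t)"
    by (intro prod.cong refl) (simp add: adjoin_embedding_ev)
  also have "\<dots> = ev (?c r1) t * ev (?c r2) t * ev (?c r3) t"
    unfolding R using order by simp
  also have "\<dots> = ?c (ev r1 t * ev r2 t * ev r3 t)"
    by (cases t) simp
  also have "\<dots> = of_rat (of_int (cubic_norm a b t))"
    unfolding prod_ev by simp
  finally show ?thesis
    unfolding field_norm_def by (intro the_equality) (simp_all only: of_rat_eq_iff)
qed

lemma field_norm_alpha:
  "field_norm (field_adjoin \<rho>) (alpha a b \<rho> v W) = of_int (face_norm a b v W)"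
proof -
  have "alpha a b \<rho> v W = ev \<rho> (- v, b * (a * v + W) + 1, - (a * v + W))"
    by (simp add: alpha_def algebra_simps)
  then show ?thesis
    by (simp only: field_norm_ev cubic_norm_alpha)
qed

lemma indecomposable_norm_bound:
  assumes "indecomposable_in (field_adjoin \<rho>) (order_adjoin \<rho>) \<alpha>"
  shows "\<exists>v\<in>{(b - a - 1) div 2..b - a - 1}.
    field_norm (field_adjoin \<rho>) \<alpha> \<le> of_int (face_norm a b v (a - 1))"
proof -
  note order_eq = order_adjoin_eq_range_ev[OF \<rho>]
  obtain t where \<alpha>: "\<alpha> = ev \<rho> t"
    using assms unfolding indecomposable_in_def order_eq by blast
  have pos: "0 < ev r1 t" "0 < ev r2 t" "0 < ev r3 t"
    using assms totally_positive_ev[of t] unfolding indecomposable_in_def \<alpha> by blast+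
  have indec: False if "ev \<rho> t = ev \<rho> u + ev \<rho> v"
    "totally_positive (field_adjoin \<rho>) (ev \<rho> u)"
    "totally_positive (field_adjoin \<rho>) (ev \<rho> v)" for u v
    using assms that unfolding indecomposable_in_def order_eq \<alpha> by blast
  define s where "s = mult_shift a b b t"
  \<comment> \<open>\<open>\<rho> (\<rho> - a)\<close> is the inverse of \<open>\<rho> - b\<close>.\<close>
  define \<phi> where "\<phi> u = mult_root a b (mult_shift a b a u)" for u
  have \<phi>_add: "\<phi> (u + v) = \<phi> u + \<phi> v" for u v
    by (simp add: \<phi>_def mult_root_add mult_shift_add)
  have \<phi>_s: "ev r (\<phi> s) = ev r t" if "r * (r - of_int a) * (r - of_int b) = 1"
    for r :: "'c::comm_ring_1"
  proof -
    have "ev r (\<phi> s) = (r * (r - of_int a) * (r - of_int b)) * ev r t"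
      by (simp add: \<phi>_def s_def ev_mult_root[OF that] ev_mult_shift[OF that] ac_simps)
    then show ?thesis by (simp add: that)
  qed
  \<comment> \<open>The factor \<open>r * (r - a)\<close> has signs (-, -, +) at the three roots, so
    summands of \<open>s\<close> return to totally positive summands of \<open>t\<close>.\<close>
  have \<phi>_pos: "totally_positive (field_adjoin \<rho>) (ev \<rho> (\<phi> u))" if "signed u" for u
    unfolding totally_positive_ev \<phi>_def
    using that r1 r2 r3 order by (auto simp: signed_def ev_mult_root ev_mult_shift root mult_neg_neg zero_less_mult_iff)
  have "signed_indec s"
    unfolding signed_indec_def
  proof (intro conjI allI impI notI)
    show "signed s"
      using pos order r3 by (simp add: signed_def s_def ev_mult_shift root mult_neg_pos)
    fix u v assume "signed u" "signed v" "s = u + v"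
    then show False
      using indec[of "\<phi> u" "\<phi> v"] \<phi>_pos \<phi>_s[OF \<rho>] by (simp add: \<phi>_add ev_add)
  qed
  moreover have "cubic_norm a b s = cubic_norm a b t"
    by (simp add: s_def norm_mult_shift)
  ultimately show ?thesis
    using signed_indec_norm_bound[of s] by (simp add: \<alpha> field_norm_ev)
qed

end

theorem proposition5p7:
  fixes a b L l0 :: int and \<rho> \<alpha> :: complex
  assumes "2 \<le> a" and "a \<le> b - 2"
    and "poly [:- 1, of_int (a * b), - of_int (a + b), 1:] \<rho> = 0"
    and "b - a = 2 * L + l0" and "l0 \<in> {0, 1}"
    and "indecomposable_in (field_adjoin \<rho>) (order_adjoin \<rho>) \<alpha>"
  shows "field_norm (field_adjoin \<rho>) \<alpha> \<le>
    (if a = 2 \<and> b = 4 then 16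
     else if l0 = 0 then
       Max ((\<lambda>v. field_norm (field_adjoin \<rho>) (alpha a b \<rho> v (a - 1))) ` {L - 1..2 * L - 1})
     else
       Max ((\<lambda>v. field_norm (field_adjoin \<rho>) (alpha a b \<rho> v (a - 1))) ` {L..2 * L}))"
proof -
  have ab: "a + 2 \<le> b"
    using assms(2) by linarith
  obtain r1 r2 r3 where "cubic_roots a b r1 r2 r3"
    using cubic_roots_exist[OF assms(1) ab] .
  then interpret cubic_roots a b r1 r2 r3 .
  have "\<rho> ^ 3 - of_int (a + b) * \<rho> ^ 2 + of_int (a * b) * \<rho> - 1 = 0"
    using assms(3) by (simp add: algebra_simps power2_eq_square power3_eq_cube)
  then interpret cubic_field a b r1 r2 r3 \<rho>
    by unfold_locales (simp only: cubic_poly_eq_0_iff)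
  obtain v where v: "v \<in> {(b - a - 1) div 2..b - a - 1}"
    and le: "field_norm (field_adjoin \<rho>) \<alpha> \<le> of_int (face_norm a b v (a - 1))"
    using indecomposable_norm_bound[OF assms(6)] by blast
  have Max: "field_norm (field_adjoin \<rho>) \<alpha> \<le>
      Max ((\<lambda>v. field_norm (field_adjoin \<rho>) (alpha a b \<rho> v (a - 1))) ` A)"
    if "v \<in> A" "finite A" for A
    using that le by (subst Max_ge_iff) (auto simp: field_norm_alpha)
  consider "a = 2" "b = 4" | "\<not> (a = 2 \<and> b = 4)" "l0 = 0" | "\<not> (a = 2 \<and> b = 4)" "l0 = 1"
    using assms(5) by blast
  then show ?thesis
  proof cases
    case 1
    then have "v = 0 \<or> v = 1"
      using v by auto
    \<comment> \<open>The two values are 14 for \<open>v = 0\<close> and 16 for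
      \<open>v = 1\<close>.\<close>
    then have "face_norm a b v (a - 1) \<le> 16"
      using 1 by (auto simp: face_norm_def cubic_norm_def)
    then have "of_int (face_norm a b v (a - 1)) \<le> (of_int 16 :: rat)"
      by (simp only: of_int_le_iff)
    with le 1 show ?thesis by simp
  next
    case 2
    \<comment> \<open>Here \<open>b - a - 1 = 2 * L - 1\<close> is odd and its half rounds down to
      \<open>L - 1\<close>; for \<open>l0 = 1\<close> it is \<open>2 * L\<close> and the half is
      exactly \<open>L\<close>.\<close>
    then have "v \<in> {L - 1..2 * L - 1}"
      using v assms(4) by auto
    from Max[OF this] 2 show ?thesis by auto
  next
    case 3
    then have "v \<in> {L..2 * L}"
      using v assms(4) by auto
    from Max[OF this] 3 show ?thesis by auto
  qed
qed

end
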